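(* Let $\mathcal{C}=\{\mathcal{C}_n,\ n\in\mathbb{N}\}$ be a quasianalytic system. If $\mathcal{C}$ satisfies Weierstrass preparation, then it coincides with the analytic system: for all $n\in\mathbb{N}$, $\mathcal{C}_n=\mathcal{A}_n$.
   Context: Notation: for $n\in\mathbb{N}$ (with $0\in\mathbb{N}$), $\mathcal{E}_n$ is the ring of germs at the origin of $\mathbb{R}^n$ of smooth ($C^\infty$) real-valued functions, and $\mathcal{A}_n\subset\mathcal{E}_n$ is the subring of (real) analytic germs. For $f\in\mathcal{E}_n$, $\hat f\in\mathbb{R}[[x_1,\ldots,x_n]]$ denotes its infinite Taylor expansion at the origin. Write $\boldsymbol{x}=(x_1,\ldots,x_n)$ and $\boldsymbol{x}'=(x_1,\ldots,x_{n-1})$. Quasianalytic system: a collection $\mathcal{C}=\{\mathcal{C}_n,\ n\in\mathbb{N}\}$, where each $\mathcal{C}_n$ is a subring of $\mathcal{E}_n$, is a quasianalytic system if the following hold for all $n\in\mathbb{N}$ (with $n>0$ in (3) and (4)): (1) $\mathcal{A}_n\subset\mathcal{C}_n$. (2) (Stability by composition) For every $m\in\mathbb{N}$, if $f\in\mathcal{C}_n$ and $g_1,\ldots,g_n\in\mathcal{C}_m$ with $g_1(0)=\cdots=g_n(0)=0$, then $f(g_1,\ldots,g_n)\in\mathcal{C}_m$. (3) (Stability by implicit equation) If $f\in\mathcal{C}_n$ satisfies $f(0)=0$ and $(\partial f/\partial x_n)(0)\neq 0$, then there exists $\varphi\in\mathcal{C}_{n-1}$ such that $\varphi(0)=0$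 and $f(\boldsymbol{x}',\varphi(\boldsymbol{x}'))=0$. (4) (Stability under monomial division) If $f\in\mathcal{C}_n$ satisfies $f(\boldsymbol{x}',0)=0$, then there exists $g\in\mathcal{C}_n$ such that $f(\boldsymbol{x})=x_n g(\boldsymbol{x})$. (5) (Quasianalyticity) The Taylor map $f\mapsto\hat f$ is injective on $\mathcal{C}_n$. Order: for $n\ge 1$ and $d\in\mathbb{N}$, a germ $f\in\mathcal{E}_n$ is of order $d$ in the variable $x_n$ if $f(\boldsymbol{0},x_n)=x_n^d u(x_n)$ with $u\in\mathcal{E}_1$, $u(0)\neq 0$. Weierstrass preparation: a quasianalytic system $\mathcal{C}$ satisfies Weierstrass preparation if for all $n\ge 1$ the following statement $(\mathcal{W}_n)$ holds: every $f\in\mathcal{C}_n$ of order $d$ in the variable $x_n$ can be written $$f=U(\boldsymbol{x})\left(x_n^d+a_1(\boldsymbol{x}')x_n^{d-1}+\cdots+a_d(\boldsymbol{x}')\right),$$ where $U\in\mathcal{C}_n$, $a_1,\ldots,a_d\in\mathcal{C}_{n-1}$, $U(0)\neq 0$ and $a_1(0)=\cdots=a_d(0)=0$. All equalities are equalities of germs at the origin. *)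

theory Defs
  imports "HOL-Analysis.Analysis"
begin

text \<open>
  The space of dimension \<open>n\<close> is the library's \<open>Euclidean_space n\<close>: its points are the
  \<open>x :: nat \<Rightarrow> real\<close> with \<open>x i = 0\<close> for all \<open>i \<ge> n\<close>, so that the dimension can vary inside a
  statement. Coordinates are numbered from \<open>0\<close>: the last coordinate of a point of
  \<open>Euclidean_space (Suc n)\<close> is \<open>x n\<close>, and \<open>x(n := 0)\<close> is its projection to
  \<open>Euclidean_space n\<close>. Functions are total on \<open>nat \<Rightarrow> real\<close>, but only their values on
  \<open>Euclidean_space n\<close> matter for their germs in dimension \<open>n\<close>.
\<close>

type_synonym point = "nat \<Rightarrow> real"
type_synonym germ = "(point \<Rightarrow> real) set"

abbreviation origin :: point where
  "origin \<equiv> (\<lambda>_. 0)"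

text \<open>The filter \<open>near_origin n\<close> includes the origin itself, as \<open>nhdsin\<close> is not punctured.\<close>

abbreviation near_origin :: "nat \<Rightarrow> point filter" where
  "near_origin n \<equiv> nhdsin (Euclidean_space n) origin"

definition germ :: "nat \<Rightarrow> (point \<Rightarrow> real) \<Rightarrow> germ" where
  "germ n f = {g. \<forall>\<^sub>F x in near_origin n. g x = f x}"

definition partial_deriv :: "nat \<Rightarrow> (point \<Rightarrow> real) \<Rightarrow> point \<Rightarrow> real" where
  "partial_deriv i f x = deriv (\<lambda>t. f (x(i := t))) (x i)"

text \<open>
  Smoothness on an open set: all iterated partial derivatives exist and are continuous. The
  list \<open>is\<close> gives the successive directions of differentiation. The differentiability clause is
  needed because \<open>deriv\<close> is total.
\<close>

definition smooth_on :: "nat \<Rightarrow> point set \<Rightarrow> (point \<Rightarrow> real) \<Rightarrow> bool" where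
  "smooth_on n U f \<longleftrightarrow>
     (\<forall>is. set is \<subseteq> {..<n} \<longrightarrow>
        continuous_map (subtopology (Euclidean_space n) U) euclideanreal (foldr partial_deriv is f) \<and>
        (\<forall>x\<in>U. \<forall>i<n. (\<lambda>t. foldr partial_deriv is f (x(i := t))) field_differentiable at (x i)))"

definition smooth_germs :: "nat \<Rightarrow> germ set" where
  "smooth_germs n =
     {germ n f | f. \<exists>U. openin (Euclidean_space n) U \<and> origin \<in> U \<and> smooth_on n U f}"

definition multi_indices :: "nat \<Rightarrow> (nat \<Rightarrow> nat) set" where
  "multi_indices n = {\<alpha>. \<forall>i\<ge>n. \<alpha> i = 0}"

definition analytic_germs :: "nat \<Rightarrow> germ set" where
  "analytic_germs n =
     {germ n f | f. \<exists>c. \<forall>\<^sub>F x in near_origin n.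
        ((\<lambda>\<alpha>. c \<alpha> * (\<Prod>i<n. x i ^ \<alpha> i)) has_sum f x) (multi_indices n)}"

text \<open>
  A formal power series in \<open>n\<close> variables is the family of its coefficients, indexed by
  \<open>multi_indices n\<close>.
\<close>

definition taylor_series :: "nat \<Rightarrow> (point \<Rightarrow> real) \<Rightarrow> (nat \<Rightarrow> nat) \<Rightarrow> real" where
  "taylor_series n f =
     (\<lambda>\<alpha>\<in>multi_indices n.
        foldr partial_deriv (concat (map (\<lambda>i. replicate (\<alpha> i) i) [0..<n])) f origin
          / (\<Prod>i<n. fact (\<alpha> i)))"

definition subring_of_smooth_germs :: "nat \<Rightarrow> germ set \<Rightarrow> bool" where
  "subring_of_smooth_germs n A \<longleftrightarrow>
     A \<subseteq> smooth_germs n \<and>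
     germ n (\<lambda>_. 0) \<in> A \<and>
     germ n (\<lambda>_. 1) \<in> A \<and>
     (\<forall>f. germ n f \<in> A \<longrightarrow> germ n (\<lambda>x. - f x) \<in> A) \<and>
     (\<forall>f g. germ n f \<in> A \<and> germ n g \<in> A \<longrightarrow> germ n (\<lambda>x. f x + g x) \<in> A) \<and>
     (\<forall>f g. germ n f \<in> A \<and> germ n g \<in> A \<longrightarrow> germ n (\<lambda>x. f x * g x) \<in> A)"

locale quasianalytic_system =
  fixes C :: "nat \<Rightarrow> germ set"
  assumes subring: "\<And>n. subring_of_smooth_germs n (C n)"
    and analytic_subset: "\<And>n. analytic_germs n \<subseteq> C n"
    and composition:
      "\<And>n m f g. \<lbrakk>germ n f \<in> C n; \<And>i. i < n \<Longrightarrow> germ m (g i) \<in> C m; \<And>i. i < n \<Longrightarrow> g i origin = 0\<rbrakk>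
        \<Longrightarrow> germ m (\<lambda>x. f (\<lambda>i. if i < n then g i x else 0)) \<in> C m"
    and implicit_equation:
      "\<And>n f. \<lbrakk>germ (Suc n) f \<in> C (Suc n); f origin = 0; partial_deriv n f origin \<noteq> 0\<rbrakk>
        \<Longrightarrow> \<exists>\<phi>. germ n \<phi> \<in> C n \<and> \<phi> origin = 0 \<and>
              (\<forall>\<^sub>F x in near_origin n. f (x(n := \<phi> x)) = 0)"
    and monomial_division:
      "\<And>n f. \<lbrakk>germ (Suc n) f \<in> C (Suc n); \<forall>\<^sub>F x in near_origin n. f (x(n := 0)) = 0\<rbrakk>
        \<Longrightarrow> \<exists>g. germ (Suc n) g \<in> C (Suc n) \<and>
              (\<forall>\<^sub>F x in near_origin (Suc n). f x = x n * g x)"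
    and quasianalyticity:
      "\<And>n f g. \<lbrakk>germ n f \<in> C n; germ n g \<in> C n; taylor_series n f = taylor_series n g\<rbrakk>
        \<Longrightarrow> germ n f = germ n g"

definition order_in_last_variable :: "nat \<Rightarrow> (point \<Rightarrow> real) \<Rightarrow> nat \<Rightarrow> bool" where
  "order_in_last_variable n f d \<longleftrightarrow>
     (\<exists>u. germ 1 u \<in> smooth_germs 1 \<and> u origin \<noteq> 0 \<and>
        (\<forall>\<^sub>F t in near_origin 1. f (origin(n := t 0)) = t 0 ^ d * u t))"

definition weierstrass_preparation :: "(nat \<Rightarrow> germ set) \<Rightarrow> bool" where
  "weierstrass_preparation C \<longleftrightarrow>
     (\<forall>n f d. germ (Suc n) f \<in> C (Suc n) \<and> order_in_last_variable n f d \<longrightarrow>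
        (\<exists>U a. germ (Suc n) U \<in> C (Suc n) \<and> U origin \<noteq> 0 \<and>
           (\<forall>j\<in>{1..d}. germ n (a j) \<in> C n \<and> a j origin = 0) \<and>
           (\<forall>\<^sub>F x in near_origin (Suc n).
              f x = U x * (x n ^ d + (\<Sum>j=1..d. a j (x(n := 0)) * x n ^ (d - j))))))"

end

theory Submission
  imports Defs "HOL-Complex_Analysis.Complex_Analysis"
begin

text \<open>
  The point is that Weierstrass preparation gives every function of the system a holomorphic
  extension in one variable, on a disc that does not depend on the remaining variables.
  
  Let \<open>f\<close> be in \<open>C n\<close> and consider \<open>h \<theta> s = f (s \<theta>)\<close>, a function of \<open>n + 1\<close> variables. Preparation of
  \<open>z\<^sup>2 + y\<^sup>2 + t * h \<theta> (s + z)\<close>, which has order \<open>2\<close> in \<open>z\<close>, yields, after taking the part of first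
  order in \<open>t\<close>, a Weierstrass division (\<open>weierstrass_division\<close>)
  \<open>h \<theta> (s + z) = Q * (z\<^sup>2 + y\<^sup>2) + z * \<alpha> + \<beta>\<close>, with \<open>\<alpha>\<close> and \<open>\<beta>\<close> in the system and functions of
  \<open>\<theta>, s, y\<close> only. Formally, \<open>z = \<i> y\<close> gives \<open>h \<theta> (s + \<i> y) = \<beta> + \<i> y \<alpha>\<close>, so \<open>\<beta>\<close> and \<open>y \<alpha>\<close> should be the real
  and imaginary parts of a holomorphic function of \<open>s + \<i> y\<close>. The Cauchy-Riemann equations follow by
  differentiating the division and using that division by \<open>z\<^sup>2 + y\<^sup>2\<close> is unique (\<open>division_unique\<close>);
  this is the place where quasianalyticity is used, because a remainder that is zero only formally
  has to vanish as a germ.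
  
  Cauchy's estimates then bound the Taylor coefficients of \<open>s \<mapsto> f (s \<theta>)\<close> by \<open>M * R ^ k\<close>, uniformly for \<open>\<theta>\<close>
  in a cube. Iterating Hadamard's lemma inside the system shows that the \<open>k\<close>-th coefficient is a
  homogeneous polynomial of degree \<open>k\<close> in \<open>\<theta>\<close> (\<open>ray_expansion\<close>). A homogeneous polynomial of degree \<open>k\<close>
  that is bounded by \<open>B\<close> on a cube of size \<open>\<delta>\<close> has coefficients bounded by \<open>B * (8 / \<delta>) ^ k\<close>
  (\<open>coefficient_bound\<close>), so the multivariate power series converges absolutely near the origin, and
  along rays its sum is \<open>f\<close>.
\<close>

section \<open>Neighbourhoods of the origin\<close>

definition cube :: "nat \<Rightarrow> real \<Rightarrow> point set" where
  "cube n \<delta> = {x. (\<forall>i<n. \<bar>x i\<bar> < \<delta>) \<and> (\<forall>i\<ge>n. x i = 0)}"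

lemma cubeD: "x \<in> cube n \<delta> \<Longrightarrow> i < n \<Longrightarrow> \<bar>x i\<bar> < \<delta>" "x \<in> cube n \<delta> \<Longrightarrow> n \<le> i \<Longrightarrow> x i = 0"
  by (auto simp: cube_def)

lemma cube_mono: "\<delta> \<le> \<epsilon> \<Longrightarrow> cube n \<delta> \<subseteq> cube n \<epsilon>"
  by (force simp: cube_def)

lemma cube_Suc: "0 < \<delta> \<Longrightarrow> cube n \<delta> \<subseteq> cube (Suc n) \<delta>"
  by (fastforce simp: cube_def less_Suc_eq)

lemma origin_in_cube: "0 < \<delta> \<Longrightarrow> origin \<in> cube n \<delta>"
  by (simp add: cube_def)

lemma cube_upd: "x \<in> cube n \<delta> \<Longrightarrow> i < n \<Longrightarrow> \<bar>u\<bar> < \<delta> \<Longrightarrow> x(i := u) \<in> cube n \<delta>"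
  by (auto simp: cube_def)

lemma openin_cube: "openin (Euclidean_space n) (cube n \<delta>)"
proof -
  have "open {x::point. \<bar>x i\<bar> < \<delta>}" for i
    by (intro open_Collect_less continuous_intros)
      (use continuous_on_product_coordinates[of i] in auto)
  then have "open (\<Inter>i\<in>{..<n}. {x::point. \<bar>x i\<bar> < \<delta>})"
    by (intro open_INT) auto
  moreover have "cube n \<delta> = {x. \<forall>i\<ge>n. x i = 0} \<inter> (\<Inter>i\<in>{..<n}. {x. \<bar>x i\<bar> < \<delta>})"
    by (auto simp: cube_def)
  ultimately show ?thesis
    unfolding Euclidean_space_def euclidean_product_topology by (simp add: openin_open_Int)
qed

text \<open>
  Only finitely many coordinates of a point of \<open>Euclidean_space n\<close> are free, so the cubes form a basis
  of neighbourhoods of the origin although the ambient topology is a product topology.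
\<close>

lemma eventually_near_origin:
  "eventually P (near_origin n) \<longleftrightarrow> (\<exists>\<delta>>0. \<forall>x\<in>cube n \<delta>. P x)"
proof
  assume "\<exists>\<delta>>0. \<forall>x\<in>cube n \<delta>. P x"
  then obtain \<delta> where "\<delta> > 0" "\<And>x. x \<in> cube n \<delta> \<Longrightarrow> P x"
    by auto
  then show "eventually P (near_origin n)"
    unfolding eventually_nhdsin
    by (intro disjI2 exI[of _ "cube n \<delta>"]) (simp add: openin_cube origin_in_cube)
next
  assume "eventually P (near_origin n)"
  then obtain S where S: "openin (Euclidean_space n) S" "origin \<in> S" "\<And>x. x \<in> S \<Longrightarrow> P x"
    by (auto simp: eventually_nhdsin topspace_Euclidean_space)
  then obtain T where T: "open T" "S = {x. \<forall>i\<ge>n. x i = 0} \<inter> T"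
    by (auto simp: Euclidean_space_def euclidean_product_topology openin_open)
  then obtain X where X: "origin \<in> (\<Pi>\<^sub>E i\<in>UNIV. X i)" "\<And>i. open (X i)" "(\<Pi>\<^sub>E i\<in>UNIV. X i) \<subseteq> T"
    using product_topology_open_contains_basis[of "\<lambda>_. euclideanreal" UNIV T origin] S(2)
    by (auto simp: open_fun_def)
  have "\<exists>e>0. \<forall>u. \<bar>u\<bar> < e \<longrightarrow> u \<in> X i" for i
  proof -
    have "0 \<in> X i" using X(1) by auto
    then show ?thesis
      using X(2)[of i] by (force simp: open_dist dist_real_def)
  qed
  then obtain e :: "nat \<Rightarrow> real" where e: "\<And>i. e i > 0" "\<And>i u::real. \<bar>u\<bar> < e i \<Longrightarrow> u \<in> X i"
    by metis
  define \<delta> where "\<delta> = Min (insert 1 (e ` {..<n}))"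
  have "\<delta> > 0" using e(1) by (auto simp: \<delta>_def)
  moreover have "P x" if x: "x \<in> cube n \<delta>" for x
  proof (rule S(3))
    have "x i \<in> X i" for i
    proof (cases "i < n")
      case True
      then have "\<delta> \<le> e i" by (auto simp: \<delta>_def)
      then show ?thesis using e(2)[of "x i" i] cubeD(1)[OF x True] by linarith
    next
      case False
      then show ?thesis using e(1)[of i] e(2)[of 0 i] cubeD(2)[OF x] by simp
    qed
    then have "x \<in> T" using X(3) by blast
    then show "x \<in> S" using x by (auto simp: T cube_def)
  qed
  ultimately show "\<exists>\<delta>>0. \<forall>x\<in>cube n \<delta>. P x" by blast
qed

lemma eventually_near_originE:
  assumes "eventually P (near_origin n)"
  obtains \<delta> where "\<delta> > 0" "\<And>x. x \<in> cube n \<delta> \<Longrightarrow> P x"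
  using assms by (auto simp: eventually_near_origin)

lemma eventually_near_originI:
  assumes "\<delta> > 0" "\<And>x. x \<in> cube n \<delta> \<Longrightarrow> P x"
  shows "eventually P (near_origin n)"
  using assms by (auto simp: eventually_near_origin)

lemma near_origin_at_origin: "eventually P (near_origin n) \<Longrightarrow> P origin"
  by (auto simp: eventually_near_origin origin_in_cube)

lemma near_origin_space: "\<forall>\<^sub>F x in near_origin n. \<forall>i\<ge>n. x i = 0"
  by (rule eventually_near_originI[of 1]) (auto simp: cube_def)

lemma near_origin_SucD:
  "eventually P (near_origin (Suc n)) \<Longrightarrow> eventually P (near_origin n)"
  using cube_Suc by (fastforce simp: eventually_near_origin)

lemma filterlim_near_origin:
  assumes "\<And>i. i < n \<Longrightarrow> ((\<lambda>x. g x i) \<longlongrightarrow> 0) F" "\<forall>\<^sub>F x in F. \<forall>i\<ge>n. g x i = 0"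
  shows "filterlim g (near_origin n) F"
  unfolding filterlim_iff
proof (intro allI impI)
  fix P assume "eventually P (near_origin n)"
  then obtain \<delta> where d: "\<delta> > 0" "\<And>x. x \<in> cube n \<delta> \<Longrightarrow> P x"
    using eventually_near_originE by blast
  have "\<forall>\<^sub>F x in F. \<forall>i\<in>{..<n}. \<bar>g x i\<bar> < \<delta>"
  proof (intro eventually_ball_finite ballI)
    fix i assume "i \<in> {..<n}"
    then show "\<forall>\<^sub>F x in F. \<bar>g x i\<bar> < \<delta>"
      using tendstoD[OF assms(1)[of i] d(1)] by (simp add: dist_real_def)
  qed auto
  with assms(2) show "\<forall>\<^sub>F x in F. P (g x)"
    by eventually_elim (rule d(2), auto simp: cube_def)
qed

section \<open>Germs of a quasianalytic system\<close>

lemma germ_eq_iff: "germ n f = germ n g \<longleftrightarrow> (\<forall>\<^sub>F x in near_origin n. f x = g x)"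
proof
  assume "germ n f = germ n g"
  moreover have "f \<in> germ n f" by (simp add: germ_def)
  ultimately show "\<forall>\<^sub>F x in near_origin n. f x = g x" by (simp add: germ_def)
next
  assume *: "\<forall>\<^sub>F x in near_origin n. f x = g x"
  show "germ n f = germ n g"
    unfolding germ_def by (auto elim: eventually_elim2[OF *])
qed

lemma germ_cong: "(\<And>x. \<forall>i\<ge>n. x i = 0 \<Longrightarrow> f x = g x) \<Longrightarrow> germ n f = germ n g"
  unfolding germ_eq_iff by (rule eventually_mono[OF near_origin_space]) auto

lemma smooth_germ_continuous:
  assumes "germ n f \<in> smooth_germs n"
  obtains \<delta> where "\<delta> > 0" "continuous_on (cube n \<delta>) f"
proof -
  obtain g U where g: "germ n f = germ n g" "openin (Euclidean_space n) U" "origin \<in> U" "smooth_on n U g"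
    using assms by (auto simp: smooth_germs_def)
  have "continuous_map (subtopology (Euclidean_space n) U) euclideanreal (foldr partial_deriv [] g)"
    using g(4) unfolding smooth_on_def by (drule_tac spec[of _ "[]"]) simp
  then have cont: "continuous_on ({x. \<forall>i\<ge>n. x i = 0} \<inter> U) g"
    by (simp add: Euclidean_space_def euclidean_product_topology subtopology_subtopology)
  have "\<forall>\<^sub>F x in near_origin n. x \<in> U \<and> f x = g x"
    using g by (auto simp: germ_eq_iff eventually_conj_iff) (auto simp: eventually_nhdsin)
  then obtain \<delta> where d: "\<delta> > 0" "\<And>x. x \<in> cube n \<delta> \<Longrightarrow> x \<in> U \<and> f x = g x"
    using eventually_near_originE by blast
  have "continuous_on (cube n \<delta>) g"
    by (rule continuous_on_subset[OF cont]) (use d in \<open>auto simp: cube_def\<close>)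
  then have "continuous_on (cube n \<delta>) f"
    by (subst continuous_on_cong[OF refl]) (use d(2) in auto)
  then show ?thesis using d(1) that by blast
qed

lemma monomial_analytic:
  assumes "\<beta> \<in> multi_indices n"
  shows "germ n (\<lambda>x. k * (\<Prod>i<n. x i ^ \<beta> i)) \<in> analytic_germs n"
proof -
  have "((\<lambda>\<alpha>. (if \<alpha> = \<beta> then k else 0) * (\<Prod>i<n. x i ^ \<alpha> i)) has_sum k * (\<Prod>i<n. x i ^ \<beta> i))
      (multi_indices n)" for x :: point
    by (subst has_sum_cong_neutral[where T = "{\<beta>}" and g = "\<lambda>\<alpha>. k * (\<Prod>i<n. x i ^ \<alpha> i)"])
      (use assms in \<open>auto intro: has_sum_finiteI\<close>)
  then show ?thesis
    unfolding analytic_germs_def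
    by (auto intro!: exI[of _ "\<lambda>x. k * (\<Prod>i<n. x i ^ \<beta> i)"] exI[of _ "\<lambda>\<alpha>. if \<alpha> = \<beta> then k else 0"])
qed

lemma continuous_on_fun_upd:
  assumes "\<And>j. j \<noteq> i \<Longrightarrow> continuous_on S (\<lambda>u. f u j)" "continuous_on S g"
  shows "continuous_on S (\<lambda>u. (f u)(i := g u) :: point)"
proof (rule continuous_on_coordinatewise_then_product)
  fix j show "continuous_on S (\<lambda>u. ((f u)(i := g u)) j)"
    using assms by (cases "j = i") auto
qed

lemma continuous_on_cube_line:
  fixes f :: "point \<Rightarrow> real"
  assumes "continuous_on (cube n \<delta>) f" "x \<in> cube n \<delta>" "i < n" "\<bar>u\<bar> < \<delta>"
  shows "isCont (\<lambda>u. f (x(i := u))) u"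
proof -
  have "continuous_on {-\<delta><..<\<delta>} (\<lambda>u. f (x(i := u)))"
  proof (rule continuous_on_compose2[OF assms(1)])
    show "continuous_on {-\<delta><..<\<delta>} (\<lambda>u. x(i := u))"
      by (intro continuous_on_fun_upd continuous_intros)
    show "(\<lambda>u. x(i := u)) ` {- \<delta><..<\<delta>} \<subseteq> cube n \<delta>"
      using cube_upd[OF assms(2,3)] by auto
  qed
  then show ?thesis
    using assms(4) by (simp add: continuous_on_eq_continuous_at abs_less_iff)
qed

context quasianalytic_system
begin

abbreviation C_fun :: "nat \<Rightarrow> (point \<Rightarrow> real) \<Rightarrow> bool" where
  "C_fun n f \<equiv> germ n f \<in> C n"

lemma C_fun_eventually_cong:
  "C_fun n f \<Longrightarrow> \<forall>\<^sub>F x in near_origin n. f x = g x \<Longrightarrow> C_fun n g"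
  using germ_eq_iff by metis

lemma C_fun_cong: "C_fun n f \<Longrightarrow> (\<And>x. \<forall>i\<ge>n. x i = 0 \<Longrightarrow> f x = g x) \<Longrightarrow> C_fun n g"
  using germ_cong by metis

lemma C_fun_continuous:
  assumes "C_fun n f"
  obtains \<delta> where "\<delta> > 0" "continuous_on (cube n \<delta>) f"
proof -
  have "germ n f \<in> smooth_germs n"
    using subring[of n] assms unfolding subring_of_smooth_germs_def by auto
  then show ?thesis using smooth_germ_continuous that by metis
qed

lemma C_fun_tendsto:
  assumes "C_fun n f"
  shows "(f \<longlongrightarrow> f origin) (near_origin n)"
proof -
  obtain \<delta> where d: "\<delta> > 0" "continuous_on (cube n \<delta>) f"
    using C_fun_continuous[OF assms] .
  show ?thesis
  proof (rule topological_tendstoI)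
    fix S assume "open S" "f origin \<in> S"
    then obtain A where A: "open A" "A \<inter> cube n \<delta> = f -` S \<inter> cube n \<delta>"
      using d(2) unfolding continuous_on_open_invariant by auto
    have "origin \<in> A" using A(2) \<open>f origin \<in> S\<close> d(1) origin_in_cube by blast
    have "openin (Euclidean_space n) ({x. \<forall>i\<ge>n. x i = 0} \<inter> A)"
      unfolding Euclidean_space_def euclidean_product_topology using A(1)
      by (simp add: openin_open_Int)
    then have "\<forall>\<^sub>F x in near_origin n. x \<in> A"
      unfolding eventually_nhdsin using \<open>origin \<in> A\<close>
      by (intro disjI2 exI[of _ "{x. \<forall>i\<ge>n. x i = 0} \<inter> A"]) auto
    moreover have "\<forall>\<^sub>F x in near_origin n. x \<in> cube n \<delta>"
      by (rule eventually_near_originI[OF d(1)])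
    ultimately show "\<forall>\<^sub>F x in near_origin n. f x \<in> S"
      by eventually_elim (use A(2) in blast)
  qed
qed

lemma C_fun_add: "C_fun n f \<Longrightarrow> C_fun n g \<Longrightarrow> C_fun n (\<lambda>x. f x + g x)"
  and C_fun_mult: "C_fun n f \<Longrightarrow> C_fun n g \<Longrightarrow> C_fun n (\<lambda>x. f x * g x)"
  and C_fun_minus: "C_fun n f \<Longrightarrow> C_fun n (\<lambda>x. - f x)"
  using subring[of n] by (simp_all add: subring_of_smooth_germs_def)

lemma C_fun_diff: "C_fun n f \<Longrightarrow> C_fun n g \<Longrightarrow> C_fun n (\<lambda>x. f x - g x)"
  using C_fun_add[OF _ C_fun_minus, of n f g] by simp

lemma C_fun_const: "C_fun n (\<lambda>_. k)"
  using monomial_analytic[of "\<lambda>_. 0" n k] analytic_subset by (auto simp: multi_indices_def)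

lemma C_fun_coord: "C_fun n (\<lambda>x. x i)"
proof (cases "i < n")
  case True
  have "(\<Prod>j<n. x j ^ (if j = i then 1 else 0)) = x i" for x :: point
    using True by (simp add: if_distrib prod.delta cong: if_cong)
  then show ?thesis
    using monomial_analytic[of "\<lambda>j. if j = i then 1 else 0" n 1] analytic_subset True
    by (auto simp: multi_indices_def)
next
  case False
  show ?thesis
    by (rule C_fun_cong[OF C_fun_const[of n 0]]) (use False in auto)
qed

lemma C_fun_power: "C_fun n f \<Longrightarrow> C_fun n (\<lambda>x. f x ^ k)"
  by (induction k) (auto intro: C_fun_const C_fun_mult)

lemma C_fun_if: "(c \<Longrightarrow> C_fun n f) \<Longrightarrow> (\<not> c \<Longrightarrow> C_fun n g) \<Longrightarrow> C_fun n (\<lambda>x. if c then f x else g x)"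
  by (cases c) simp_all

lemmas C_fun_intros = C_fun_add C_fun_mult C_fun_minus C_fun_diff C_fun_const C_fun_coord
  C_fun_power C_fun_if

text \<open>
  The form in which stability by composition is used: \<open>g\<close> is a map between points, which is
  required to have its values in the space of dimension \<open>n\<close>. Restriction to a coordinate subspace,
  renaming of variables and adding dummy variables are all instances.
\<close>

lemma C_fun_subst:
  assumes "C_fun n f" "\<And>i. i < n \<Longrightarrow> C_fun m (\<lambda>x. g x i)" "\<And>i. i < n \<Longrightarrow> g origin i = 0"
    and "\<And>x i. \<forall>j\<ge>m. x j = 0 \<Longrightarrow> n \<le> i \<Longrightarrow> g x i = 0"
  shows "C_fun m (\<lambda>x. f (g x))"
proof (rule C_fun_cong[OF composition[OF assms(1), of m "\<lambda>i x. g x i"]])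
  fix x :: point assume "\<forall>i\<ge>m. x i = 0"
  then have "(\<lambda>i. if i < n then g x i else 0) = g x"
    using assms(4) by (auto simp: fun_eq_iff)
  then show "f (\<lambda>i. if i < n then g x i else 0) = f (g x)" by simp
qed (use assms in auto)

lemma eventually_subst:
  assumes "eventually P (near_origin n)" "\<And>i. i < n \<Longrightarrow> C_fun m (\<lambda>x. g x i)"
    "\<And>i. i < n \<Longrightarrow> g origin i = 0"
    and "\<And>x i. \<forall>j\<ge>m. x j = 0 \<Longrightarrow> n \<le> i \<Longrightarrow> g x i = 0"
  shows "\<forall>\<^sub>F x in near_origin m. P (g x)"
proof -
  have "filterlim g (near_origin n) (near_origin m)"
  proof (rule filterlim_near_origin)
    show "((\<lambda>x. g x i) \<longlongrightarrow> 0) (near_origin m)" if "i < n" for i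
      using C_fun_tendsto[OF assms(2)[OF that]] assms(3)[OF that] by simp
    show "\<forall>\<^sub>F x in near_origin m. \<forall>i\<ge>n. g x i = 0"
      by (rule eventually_mono[OF near_origin_space]) (use assms(4) in auto)
  qed
  with assms(1) show ?thesis unfolding filterlim_iff by blast
qed

text \<open>
  The implicit equation \<open>(u + 1 / f 0) * f x = 1\<close> in the unknown \<open>u\<close> has a solution in the system, which
  gives inverses without expanding \<open>1 / (c + u)\<close> in a power series. The shift by \<open>1 / f 0\<close> makes the
  solution vanish at the origin.
\<close>

lemma C_fun_inverse:
  assumes "C_fun n f" "f origin \<noteq> 0"
  obtains g where "C_fun n g" "\<forall>\<^sub>F x in near_origin n. g x * f x = 1"
proof -
  define F where "F = (\<lambda>x. (x n + inverse (f origin)) * f (x(n := 0)) - 1)"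
  have "C_fun (Suc n) (\<lambda>x. f (x(n := 0)))"
    by (rule C_fun_subst[OF assms(1)]) (auto simp: fun_upd_def intro!: C_fun_intros)
  then have "C_fun (Suc n) F"
    unfolding F_def by (intro C_fun_intros)
  moreover have "F origin = 0"
    using assms(2) by (simp add: F_def fun_upd_idem)
  moreover have "partial_deriv n F origin = f origin"
    unfolding partial_deriv_def F_def by (intro DERIV_imp_deriv) (auto simp: fun_upd_idem intro!: derivative_eq_intros)
  ultimately obtain \<phi> where phi: "C_fun n \<phi>" "\<phi> origin = 0" "\<forall>\<^sub>F x in near_origin n. F (x(n := \<phi> x)) = 0"
    using implicit_equation[of n F] assms(2) by auto
  show ?thesis
  proof
    show "C_fun n (\<lambda>x. \<phi> x + inverse (f origin))" by (intro C_fun_intros phi)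
    show "\<forall>\<^sub>F x in near_origin n. (\<phi> x + inverse (f origin)) * f x = 1"
      using phi(3) near_origin_space
    proof eventually_elim
      case (elim x)
      then have "x(n := 0) = x" by (simp add: fun_upd_idem)
      then show ?case using elim(1) by (simp add: F_def)
    qed
  qed
qed

end

section \<open>Partial derivatives and flat functions\<close>

lemma partial_deriv_eventually_cong:
  assumes "\<forall>\<^sub>F x in near_origin n. f x = g x" "i < n"
  shows "\<forall>\<^sub>F x in near_origin n. partial_deriv i f x = partial_deriv i g x"
proof -
  obtain \<delta> where d: "\<delta> > 0" "\<And>x. x \<in> cube n \<delta> \<Longrightarrow> f x = g x"
    using assms(1) eventually_near_originE by blast
  show ?thesis
  proof (rule eventually_near_originI[OF d(1)])
    fix x assume x: "x \<in> cube n \<delta>"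
    have "\<forall>\<^sub>F u in nhds (x i). \<bar>u\<bar> < \<delta>"
      by (rule order_tendstoD(2)[OF tendsto_rabs[OF filterlim_ident]]) (use cubeD(1)[OF x assms(2)] in simp)
    then have "\<forall>\<^sub>F u in nhds (x i). f (x(i := u)) = g (x(i := u))"
      by eventually_elim (rule d(2), rule cube_upd[OF x assms(2)])
    then show "partial_deriv i f x = partial_deriv i g x"
      unfolding partial_deriv_def by (rule deriv_cong_ev) simp
  qed
qed

context quasianalytic_system
begin

lemma C_fun_upd: "C_fun n f \<Longrightarrow> C_fun n (\<lambda>x. g x j) \<Longrightarrow> C_fun n (\<lambda>x. ((g x)(i := f x)) j)"
  by (cases "j = i") simp_all

lemma C_fun_zero_coord: "C_fun n f \<Longrightarrow> C_fun n (\<lambda>x. f (x(i := 0)))"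
  by (rule C_fun_subst[where g = "\<lambda>x. x(i := 0)" and n = n])
    (auto intro!: C_fun_upd C_fun_intros)

lemma eventually_zero_coord:
  "eventually P (near_origin n) \<Longrightarrow> \<forall>\<^sub>F x in near_origin n. P (x(i := 0))"
  by (rule eventually_subst[where g = "\<lambda>x. x(i := 0)" and n = n])
    (auto intro!: C_fun_upd C_fun_intros)

lemma C_fun_lift: "C_fun n f \<Longrightarrow> C_fun (Suc n) (\<lambda>x. f (x(n := 0)))"
  by (rule C_fun_subst[where g = "\<lambda>x. x(n := 0)" and n = n])
    (auto intro!: C_fun_upd C_fun_intros)

lemma eventually_lift:
  "eventually P (near_origin n) \<Longrightarrow> \<forall>\<^sub>F x in near_origin (Suc n). P (x(n := 0))"
  by (rule eventually_subst[where g = "\<lambda>x. x(n := 0)" and n = n])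
    (auto intro!: C_fun_upd C_fun_intros)

lemma C_fun_cancel_coord:
  assumes "C_fun n f" "i < n" "\<forall>\<^sub>F x in near_origin n. x i * f x = 0"
  shows "\<forall>\<^sub>F x in near_origin n. f x = 0"
proof -
  obtain \<delta>1 where d1: "\<delta>1 > 0" "continuous_on (cube n \<delta>1) f"
    using C_fun_continuous[OF assms(1)] .
  obtain \<delta>2 where d2: "\<delta>2 > 0" "\<And>x. x \<in> cube n \<delta>2 \<Longrightarrow> x i * f x = 0"
    using assms(3) eventually_near_originE by blast
  define \<delta> where "\<delta> = min \<delta>1 \<delta>2"
  have d: "\<delta> > 0" "continuous_on (cube n \<delta>) f" "\<And>x. x \<in> cube n \<delta> \<Longrightarrow> x i * f x = 0"
    using d1 d2 cube_mono[of \<delta> \<delta>1 n] cube_mono[of \<delta> \<delta>2 n] continuous_on_subset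
    by (auto simp: \<delta>_def)
  show ?thesis
  proof (rule eventually_near_originI[OF d(1)])
    fix x assume x: "x \<in> cube n \<delta>"
    show "f x = 0"
    proof (cases "x i = 0")
      case True
      have "isCont (\<lambda>u. f (x(i := u))) 0"
        by (rule continuous_on_cube_line[OF d(2) x assms(2)]) (use d in auto)
      then have lim: "((\<lambda>u. f (x(i := u))) \<longlongrightarrow> f x) (at 0)"
        using True by (simp add: isCont_def fun_upd_idem)
      have "\<forall>\<^sub>F u in at 0. \<bar>u\<bar> < \<delta>"
        using d(1) unfolding eventually_at by (auto simp: dist_real_def)
      moreover have "\<forall>\<^sub>F u::real in at 0. u \<noteq> 0"
        by (simp add: eventually_at_filter)
      ultimately have "\<forall>\<^sub>F u in at 0. f (x(i := u)) = 0"
      proof eventually_elim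
        case (elim u)
        then show ?case using d(3)[OF cube_upd[OF x assms(2), of u]] by simp
      qed
      then have "((\<lambda>u. f (x(i := u))) \<longlongrightarrow> 0) (at 0)"
        by (rule tendsto_eventually)
      with lim show ?thesis using LIM_unique by blast
    qed (use d(3)[OF x] in auto)
  qed
qed

text \<open>
  Monomial division concerns the last coordinate; exchanging two coordinates extends it to all of them.
\<close>

lemma C_fun_divide_coord:
  assumes "C_fun n f" "i < n" "\<forall>\<^sub>F x in near_origin n. f (x(i := 0)) = 0"
  obtains g where "C_fun n g" "\<forall>\<^sub>F x in near_origin n. f x = x i * g x"
proof -
  obtain k where k: "n = Suc k" using assms(2) by (cases n) auto
  define sw where "sw = (\<lambda>x::point. \<lambda>j. x (Transposition.transpose i k j))"
  have C_sw: "C_fun n (\<lambda>x. sw x j)" for j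
    unfolding sw_def by (rule C_fun_coord)
  have sw0: "sw origin j = 0" for j by (simp add: sw_def)
  have sw_space: "sw x j = 0" if "\<forall>j\<ge>n. x j = 0" "n \<le> j" for x j
    using that assms(2) by (simp add: sw_def k transpose_def)
  have sw_sw: "sw (sw x) = x" for x by (simp add: sw_def)
  define F where "F = (\<lambda>x. f (sw x))"
  have "C_fun n F"
    unfolding F_def by (rule C_fun_subst[OF assms(1) C_sw sw0 sw_space])
  moreover have "\<forall>\<^sub>F x in near_origin k. F (x(k := 0)) = 0"
  proof -
    have "\<forall>\<^sub>F x in near_origin n. f ((sw x)(i := 0)) = 0"
      by (rule eventually_subst[OF assms(3) C_sw sw0 sw_space])
    moreover have "(sw x)(i := 0) = sw (x(k := 0))" for x
    proof
      fix j show "((sw x)(i := 0)) j = sw (x(k := 0)) j"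
        by (cases "j = i"; cases "j = k") (simp_all add: sw_def transpose_def)
    qed
    ultimately have "\<forall>\<^sub>F x in near_origin n. F (x(k := 0)) = 0"
      by (simp add: F_def)
    then show ?thesis using near_origin_SucD k by simp
  qed
  ultimately obtain g where g: "C_fun n g" "\<forall>\<^sub>F x in near_origin n. F x = x k * g x"
    using monomial_division[of k F] k by auto
  show ?thesis
  proof
    show "C_fun n (\<lambda>x. g (sw x))"
      by (rule C_fun_subst[OF g(1) C_sw sw0 sw_space])
    have "\<forall>\<^sub>F x in near_origin n. F (sw x) = sw x k * g (sw x)"
      by (rule eventually_subst[OF g(2) C_sw sw0 sw_space])
    then show "\<forall>\<^sub>F x in near_origin n. f x = x i * g (sw x)"
      by (simp add: F_def sw_sw) (simp add: sw_def)
  qed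
qed

text \<open>
  The difference quotient of \<open>f\<close> in direction \<open>i\<close> is itself a function of the system, with the increment
  as a new last variable \<open>x n\<close>: it is the quotient of a monomial division by \<open>x n\<close>. Its continuity at
  increment \<open>0\<close> gives the derivative and shows that the derivative belongs to the system.
\<close>

lemma C_fun_derivative_along_axis:
  assumes "C_fun n f" "i < n"
  obtains f' where "C_fun n f'"
    "\<forall>\<^sub>F x in near_origin n. ((\<lambda>u. f (x(i := u))) has_real_derivative f' x) (at (x i))"
proof -
  define F where "F = (\<lambda>x. f (x(i := x i + x n, n := 0)) - f (x(n := 0)))"
  have "C_fun (Suc n) (\<lambda>x. f (x(i := x i + x n, n := 0)))"
    by (rule C_fun_subst[OF assms(1)]) (use assms(2) in \<open>auto simp: fun_upd_def intro!: C_fun_intros\<close>)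
  moreover have "C_fun (Suc n) (\<lambda>x. f (x(n := 0)))"
    by (rule C_fun_subst[OF assms(1)]) (auto simp: fun_upd_def intro!: C_fun_intros)
  ultimately have "C_fun (Suc n) F"
    unfolding F_def by (rule C_fun_diff)
  moreover have "\<forall>\<^sub>F x in near_origin n. F (x(n := 0)) = 0"
    using assms(2) by (simp add: F_def)
  ultimately obtain g where g: "C_fun (Suc n) g" "\<forall>\<^sub>F x in near_origin (Suc n). F x = x n * g x"
    using monomial_division by blast
  obtain \<delta>1 where d1: "\<delta>1 > 0" "continuous_on (cube (Suc n) \<delta>1) g"
    using C_fun_continuous[OF g(1)] .
  obtain \<delta>2 where d2: "\<delta>2 > 0" "\<And>x. x \<in> cube (Suc n) \<delta>2 \<Longrightarrow> F x = x n * g x"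
    using g(2) eventually_near_originE by blast
  define \<delta> where "\<delta> = min \<delta>1 \<delta>2"
  have d: "\<delta> > 0" "continuous_on (cube (Suc n) \<delta>) g"
    "\<And>x. x \<in> cube (Suc n) \<delta> \<Longrightarrow> F x = x n * g x"
    using d1 d2 cube_mono[of \<delta> \<delta>1 "Suc n"] cube_mono[of \<delta> \<delta>2 "Suc n"] continuous_on_subset
    by (auto simp: \<delta>_def)
  show ?thesis
  proof
    show "C_fun n g"
      by (rule C_fun_subst[OF g(1), of n "\<lambda>x. x"]) (auto intro: C_fun_coord)
    show "\<forall>\<^sub>F x in near_origin n. ((\<lambda>u. f (x(i := u))) has_real_derivative g x) (at (x i))"
    proof (rule eventually_near_originI[OF d(1)])
      fix x assume x: "x \<in> cube n \<delta>"
      have x': "x \<in> cube (Suc n) \<delta>" using cube_Suc[OF d(1)] x by blast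
      have xn: "x n = 0" using cubeD(2)[OF x] by simp
      have "isCont (\<lambda>u. g (x(n := u))) 0"
        by (rule continuous_on_cube_line[OF d(2) x']) (use d in auto)
      then have lim: "((\<lambda>u. g (x(n := u))) \<longlongrightarrow> g x) (at 0)"
        using xn by (simp add: isCont_def fun_upd_idem)
      have "\<forall>\<^sub>F u in at 0. \<bar>u\<bar> < \<delta>"
        using d(1) unfolding eventually_at by (auto simp: dist_real_def)
      moreover have "\<forall>\<^sub>F u::real in at 0. u \<noteq> 0"
        by (simp add: eventually_at_filter)
      ultimately have "\<forall>\<^sub>F u in at 0. g (x(n := u)) = (f (x(i := x i + u)) - f (x(i := x i))) / u"
      proof eventually_elim
        case (elim u)
        have "F (x(n := u)) = u * g (x(n := u))"
          using d(3)[OF cube_upd[OF x', of n u]] elim by simp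
        moreover have "F (x(n := u)) = f (x(i := x i + u)) - f (x(i := x i))"
          using xn assms(2) by (simp add: F_def fun_upd_twist fun_upd_idem)
        ultimately show ?case using elim(2) by simp
      qed
      with lim show "((\<lambda>u. f (x(i := u))) has_real_derivative g x) (at (x i))"
        unfolding DERIV_def by (rule Lim_transform_eventually)
    qed
  qed
qed

lemma
  assumes "C_fun n f" "i < n"
  shows C_fun_partial_deriv: "C_fun n (partial_deriv i f)"
    and C_fun_has_partial_deriv:
      "\<forall>\<^sub>F x in near_origin n. ((\<lambda>u. f (x(i := u))) has_real_derivative partial_deriv i f x) (at (x i))"
proof -
  obtain f' where f': "C_fun n f'"
    "\<forall>\<^sub>F x in near_origin n. ((\<lambda>u. f (x(i := u))) has_real_derivative f' x) (at (x i))"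
    using C_fun_derivative_along_axis[OF assms] .
  have eq: "\<forall>\<^sub>F x in near_origin n. f' x = partial_deriv i f x"
    using f'(2) by eventually_elim (simp add: partial_deriv_def DERIV_imp_deriv)
  show "C_fun n (partial_deriv i f)"
    by (rule C_fun_eventually_cong[OF f'(1) eq])
  show "\<forall>\<^sub>F x in near_origin n. ((\<lambda>u. f (x(i := u))) has_real_derivative partial_deriv i f x) (at (x i))"
    using f'(2) eq by eventually_elim simp
qed

text \<open>
  Infinite divisibility by a coordinate is inherited by all partial derivatives, hence such a function
  has Taylor series zero. In this form quasianalyticity can be applied without computing with
  formal power series.
\<close>

lemma C_fun_infinitely_divisible:
  assumes "m < n" and div: "\<And>k. \<exists>p. C_fun n p \<and> (\<forall>\<^sub>F x in near_origin n. f x = x m ^ k * p x)"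
  shows "\<forall>\<^sub>F x in near_origin n. f x = 0"
proof -
  define flat where
    "flat = (\<lambda>f. \<forall>k. \<exists>p. C_fun n p \<and> (\<forall>\<^sub>F x in near_origin n. f x = x m ^ k * p x))"
  have flat_deriv: "flat (partial_deriv i f)" if "flat f" "i < n" for f i
    unfolding flat_def
  proof
    fix k
    obtain p where p: "C_fun n p" "\<forall>\<^sub>F x in near_origin n. f x = x m ^ Suc k * p x"
      using \<open>flat f\<close> unfolding flat_def by blast
    define q where "q = (\<lambda>x. (if i = m then real (Suc k) * p x else 0) + x m * partial_deriv i p x)"
    have "C_fun n q"
      unfolding q_def by (intro C_fun_intros p(1) C_fun_partial_deriv[OF p(1) \<open>i < n\<close>])
    moreover have "\<forall>\<^sub>F x in near_origin n. partial_deriv i f x = x m ^ k * q x"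
      using partial_deriv_eventually_cong[OF p(2) \<open>i < n\<close>] C_fun_has_partial_deriv[OF p(1) \<open>i < n\<close>]
    proof eventually_elim
      case (elim x)
      have "((\<lambda>u. (x(i := u)) m ^ Suc k * p (x(i := u))) has_real_derivative x m ^ k * q x) (at (x i))"
      proof (cases "i = m")
        case True
        show ?thesis
          using DERIV_mult[OF DERIV_pow[of "Suc k"] elim(2)] True
          by (simp add: q_def algebra_simps del: power_Suc) (simp add: algebra_simps)
      next
        case False
        show ?thesis
          using DERIV_cmult[OF elim(2), of "x m ^ Suc k"] False by (simp add: q_def algebra_simps)
      qed
      then show ?case
        using elim(1) by (simp add: partial_deriv_def DERIV_imp_deriv del: power_Suc)
    qed
    ultimately show "\<exists>p. C_fun n p \<and> (\<forall>\<^sub>F x in near_origin n. partial_deriv i f x = x m ^ k * p x)"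
      by blast
  qed
  have flat_foldr: "flat (foldr partial_deriv is f)" if "set is \<subseteq> {..<n}" "flat f" for "is" f
    using that by (induction "is") (auto intro: flat_deriv)
  have flat_origin: "f origin = 0" if ff: "flat f" for f
  proof -
    obtain p where "\<forall>\<^sub>F x in near_origin n. f x = x m ^ 1 * p x"
      using ff unfolding flat_def by blast
    from near_origin_at_origin[OF this] show ?thesis by simp
  qed
  have taylor0: "taylor_series n f = (\<lambda>\<alpha>\<in>multi_indices n. 0)" if "flat f" for f
  proof -
    have "foldr partial_deriv (concat (map (\<lambda>i. replicate (\<alpha> i) i) [0..<n])) f origin = 0" for \<alpha>
      by (rule flat_origin[OF flat_foldr[OF _ that]]) auto
    then show ?thesis unfolding taylor_series_def by simp
  qed
  have "flat f" using div unfolding flat_def by blast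
  moreover have "flat (\<lambda>_. 0)"
    unfolding flat_def by (auto intro!: exI[of _ "\<lambda>_. 0"] C_fun_const)
  ultimately have "taylor_series n f = taylor_series n (\<lambda>_. 0)"
    using taylor0 by metis
  moreover have "C_fun n f"
  proof -
    obtain p where p: "C_fun n p" "\<forall>\<^sub>F x in near_origin n. f x = x m ^ 0 * p x"
      using div by blast
    have "\<forall>\<^sub>F x in near_origin n. p x = f x"
      using p(2) by eventually_elim simp
    then show ?thesis by (rule C_fun_eventually_cong[OF p(1)])
  qed
  ultimately have "germ n f = germ n (\<lambda>_. 0)"
    using quasianalyticity[OF _ C_fun_const[of n 0]] by blast
  then show ?thesis by (simp add: germ_eq_iff)
qed

end

section \<open>Weierstrass division by a sum of two squares\<close>

context quasianalytic_system
begin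

text \<open>
  Uniqueness of division by \<open>z\<^sup>2 + y\<^sup>2\<close>, where \<open>z\<close> is the last coordinate \<open>x N\<close>. Putting \<open>y = 0\<close> in
  \<open>B * (z\<^sup>2 + y\<^sup>2) + z * p + q = 0\<close> leaves a polynomial identity in \<open>z\<close> which forces \<open>q\<close>, then \<open>p\<close>, then
  \<open>B\<close> to vanish for \<open>y = 0\<close>. All three are thus divisible by \<open>y\<close>, and the quotients satisfy the same
  equation.
\<close>

lemma division_unique_step:
  assumes "y < N" "C_fun N p" "C_fun N q" "C_fun (Suc N) B"
    and eq: "\<forall>\<^sub>F x in near_origin (Suc N).
      B x * ((x N)\<^sup>2 + (x y)\<^sup>2) + x N * p (x(N := 0)) + q (x(N := 0)) = 0"
  obtains p' q' B' where "C_fun N p'" "C_fun N q'" "C_fun (Suc N) B'"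
    "\<forall>\<^sub>F x in near_origin N. p x = x y * p' x" "\<forall>\<^sub>F x in near_origin N. q x = x y * q' x"
    "\<forall>\<^sub>F x in near_origin (Suc N).
      B' x * ((x N)\<^sup>2 + (x y)\<^sup>2) + x N * p' (x(N := 0)) + q' (x(N := 0)) = 0"
proof -
  have y: "y \<noteq> N" "N \<noteq> y" "y < Suc N" using assms(1) by auto
  have p0: "C_fun (Suc N) (\<lambda>x. p (x(y := 0, N := 0)))"
    using C_fun_zero_coord[OF C_fun_lift[OF assms(2)]] .
  have B0: "C_fun (Suc N) (\<lambda>x. B (x(y := 0)))"
    by (rule C_fun_zero_coord[OF assms(4)])
  have eq0: "\<forall>\<^sub>F x in near_origin (Suc N).
      B (x(y := 0)) * (x N)\<^sup>2 + x N * p (x(y := 0, N := 0)) + q (x(y := 0, N := 0)) = 0"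
    using eventually_zero_coord[OF eq, of y] y by simp
  have q0: "\<forall>\<^sub>F x in near_origin (Suc N). q (x(y := 0, N := 0)) = 0"
    using eventually_zero_coord[OF eq0, of N] y by (simp add: fun_upd_twist[of N y])
  have restrict: "\<forall>\<^sub>F x in near_origin N. P (x(y := 0))"
    if "\<forall>\<^sub>F x in near_origin (Suc N). P (x(y := 0, N := 0))" for P :: "point \<Rightarrow> bool"
    using near_origin_SucD[OF that] near_origin_space
    by eventually_elim (use y in \<open>simp add: fun_upd_twist[of y N] fun_upd_idem\<close>)
  obtain q' where q': "C_fun N q'" "\<forall>\<^sub>F x in near_origin N. q x = x y * q' x"
    using C_fun_divide_coord[OF assms(3,1) restrict[OF q0]] .
  have "\<forall>\<^sub>F x in near_origin (Suc N). x N * (B (x(y := 0)) * x N + p (x(y := 0, N := 0))) = 0"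
    using eq0 q0 by eventually_elim (simp add: algebra_simps power2_eq_square)
  then have eq1: "\<forall>\<^sub>F x in near_origin (Suc N). B (x(y := 0)) * x N + p (x(y := 0, N := 0)) = 0"
    by (rule C_fun_cancel_coord[rotated 2]) (auto intro!: C_fun_intros B0 p0)
  have p_zero: "\<forall>\<^sub>F x in near_origin (Suc N). p (x(y := 0, N := 0)) = 0"
    using eventually_zero_coord[OF eq1, of N] y by (simp add: fun_upd_twist[of N y])
  obtain p' where p': "C_fun N p'" "\<forall>\<^sub>F x in near_origin N. p x = x y * p' x"
    using C_fun_divide_coord[OF assms(2,1) restrict[OF p_zero]] .
  have "\<forall>\<^sub>F x in near_origin (Suc N). x N * B (x(y := 0)) = 0"
    using eq1 p_zero by eventually_elim auto
  then have "\<forall>\<^sub>F x in near_origin (Suc N). B (x(y := 0)) = 0"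
    by (rule C_fun_cancel_coord[rotated 2]) (auto intro!: B0)
  then obtain B' where B': "C_fun (Suc N) B'" "\<forall>\<^sub>F x in near_origin (Suc N). B x = x y * B' x"
    using C_fun_divide_coord[OF assms(4) y(3)] by blast
  have pq': "C_fun (Suc N) (\<lambda>x. p' (x(N := 0)))" "C_fun (Suc N) (\<lambda>x. q' (x(N := 0)))"
    by (intro C_fun_lift p' q')+
  have "\<forall>\<^sub>F x in near_origin (Suc N).
      x y * (B' x * ((x N)\<^sup>2 + (x y)\<^sup>2) + x N * p' (x(N := 0)) + q' (x(N := 0))) = 0"
    using eq B'(2) eventually_lift[OF p'(2)] eventually_lift[OF q'(2)]
    by eventually_elim (use y in \<open>simp add: algebra_simps\<close>)
  then have "\<forall>\<^sub>F x in near_origin (Suc N).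
      B' x * ((x N)\<^sup>2 + (x y)\<^sup>2) + x N * p' (x(N := 0)) + q' (x(N := 0)) = 0"
    by (rule C_fun_cancel_coord[OF _ y(3), rotated]) (intro C_fun_intros B' pq')
  with p' q' B' show ?thesis using that by blast
qed

text \<open>
  Iterating the previous step makes \<open>p\<close> and \<open>q\<close> divisible by all powers of \<open>y\<close>, so they vanish.
\<close>

lemma division_unique:
  assumes "y < N" "C_fun N p" "C_fun N q" "C_fun (Suc N) B"
    and eq: "\<forall>\<^sub>F x in near_origin (Suc N).
      B x * ((x N)\<^sup>2 + (x y)\<^sup>2) + x N * p (x(N := 0)) + q (x(N := 0)) = 0"
  shows "\<forall>\<^sub>F x in near_origin N. p x = 0" "\<forall>\<^sub>F x in near_origin N. q x = 0"
    "\<forall>\<^sub>F x in near_origin (Suc N). B x = 0"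
proof -
  have main: "\<exists>p' q' B'. C_fun N p' \<and> C_fun N q' \<and> C_fun (Suc N) B' \<and>
    (\<forall>\<^sub>F x in near_origin N. p x = x y ^ k * p' x) \<and>
    (\<forall>\<^sub>F x in near_origin N. q x = x y ^ k * q' x) \<and>
    (\<forall>\<^sub>F x in near_origin (Suc N).
      B' x * ((x N)\<^sup>2 + (x y)\<^sup>2) + x N * p' (x(N := 0)) + q' (x(N := 0)) = 0)" for k
  proof (induction k)
    case 0
    show ?case using assms by (rule_tac exI[of _ p], rule_tac exI[of _ q], rule_tac exI[of _ B]) (simp add: fun_upd_def)
  next
    case (Suc k)
    then obtain p1 q1 B1 where 1: "C_fun N p1" "C_fun N q1" "C_fun (Suc N) B1"
      "\<forall>\<^sub>F x in near_origin N. p x = x y ^ k * p1 x"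
      "\<forall>\<^sub>F x in near_origin N. q x = x y ^ k * q1 x"
      "\<forall>\<^sub>F x in near_origin (Suc N).
        B1 x * ((x N)\<^sup>2 + (x y)\<^sup>2) + x N * p1 (x(N := 0)) + q1 (x(N := 0)) = 0"
      by blast
    obtain p2 q2 B2 where 2: "C_fun N p2" "C_fun N q2" "C_fun (Suc N) B2"
      "\<forall>\<^sub>F x in near_origin N. p1 x = x y * p2 x"
      "\<forall>\<^sub>F x in near_origin N. q1 x = x y * q2 x"
      "\<forall>\<^sub>F x in near_origin (Suc N).
        B2 x * ((x N)\<^sup>2 + (x y)\<^sup>2) + x N * p2 (x(N := 0)) + q2 (x(N := 0)) = 0"
      using division_unique_step[OF assms(1) 1(1,2,3,6)] .
    have "\<forall>\<^sub>F x in near_origin N. p x = x y ^ Suc k * p2 x"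
      using 1(4) 2(4) by eventually_elim simp
    moreover have "\<forall>\<^sub>F x in near_origin N. q x = x y ^ Suc k * q2 x"
      using 1(5) 2(5) by eventually_elim simp
    ultimately show ?case using 2(1,2,3,6) by blast
  qed
  show p: "\<forall>\<^sub>F x in near_origin N. p x = 0"
    by (rule C_fun_infinitely_divisible[OF assms(1)]) (use main in blast)
  show q: "\<forall>\<^sub>F x in near_origin N. q x = 0"
    by (rule C_fun_infinitely_divisible[OF assms(1)]) (use main in blast)
  have "\<forall>\<^sub>F x in near_origin (Suc N). x N * B x = 0"
    using eq eventually_lift[OF p] eventually_lift[OF q] by eventually_elim (auto simp: sum_power2_eq_zero_iff)
  then show "\<forall>\<^sub>F x in near_origin (Suc N). B x = 0"
    by (rule C_fun_cancel_coord[rotated 2]) (auto intro!: assms)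
qed

text \<open>
  Division is the derivative of preparation: prepare the deformation \<open>z\<^sup>2 + y\<^sup>2 + t * H\<close> of the divisor and
  compare first order terms in \<open>t\<close>. The new parameter \<open>t\<close> is the coordinate \<open>N\<close>, so that \<open>z\<close>, which must
  be last, moves to position \<open>Suc N\<close>. By uniqueness of division the preparation is trivial at \<open>t = 0\<close>,
  hence its data differ from the trivial ones by multiples of \<open>t\<close>, and \<open>t\<close> can be cancelled.
\<close>

lemma weierstrass_division:
  assumes "weierstrass_preparation C" "y < N" "C_fun (Suc N) H"
  obtains \<alpha> \<beta> Q where "C_fun N \<alpha>" "C_fun N \<beta>" "C_fun (Suc N) Q"
    "\<forall>\<^sub>F x in near_origin (Suc N).
      H x = Q x * ((x N)\<^sup>2 + (x y)\<^sup>2) + x N * \<alpha> (x(N := 0)) + \<beta> (x(N := 0))"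
proof -
  define z where "z = Suc N"
  have ne: "y \<noteq> N" "N \<noteq> y" "y \<noteq> z" "z \<noteq> y" "N \<noteq> z" "z \<noteq> N" "y < z" "N < z" "z < Suc z" "N < Suc z"
    using assms(2) by (auto simp: z_def)
  \<comment> \<open>\<open>H\<close> with its last variable renamed to \<open>z\<close> and \<open>t\<close> as a dummy variable.\<close>
  define H' where "H' = (\<lambda>x. H (x(N := x z, z := 0)))"
  have H': "C_fun (Suc z) H'"
    unfolding H'_def
    by (rule C_fun_subst[OF assms(3)]) (auto simp: z_def intro!: C_fun_upd C_fun_intros)
  define G where "G = (\<lambda>x. (x z)\<^sup>2 + (x y)\<^sup>2 + x N * H' x)"
  have "C_fun (Suc z) G"
    unfolding G_def by (intro C_fun_intros H')
  moreover have "order_in_last_variable z G 2"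
  proof -
    have "germ 1 (\<lambda>_. 1) \<in> smooth_germs 1"
      using subring[of 1] unfolding subring_of_smooth_germs_def by auto
    then show ?thesis
      unfolding order_in_last_variable_def
      by (intro exI[of _ "\<lambda>_. 1"]) (use ne in \<open>auto simp: G_def\<close>)
  qed
  ultimately obtain U a where U: "C_fun (Suc z) U" "U origin \<noteq> 0"
    and a: "\<And>j. j \<in> {1..2} \<Longrightarrow> C_fun z (a j)"
    and eqU: "\<forall>\<^sub>F x in near_origin (Suc z).
      G x = U x * (x z ^ 2 + (\<Sum>j=1..2. a j (x(z := 0)) * x z ^ (2 - j)))"
    using assms(1) unfolding weierstrass_preparation_def by blast
  have a12: "C_fun z (a 1)" "C_fun z (a 2)" by (auto intro: a)
  obtain V where V: "C_fun (Suc z) V" "\<forall>\<^sub>F x in near_origin (Suc z). V x * U x = 1"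
    using C_fun_inverse[OF U] .
  have eqV: "\<forall>\<^sub>F x in near_origin (Suc z).
      V x * G x = (x z)\<^sup>2 + x z * a 1 (x(z := 0)) + a 2 (x(z := 0))"
    using eqU V(2)
  proof eventually_elim
    case (elim x)
    have "(\<Sum>j=1..2. a j (x(z := 0)) * x z ^ (2 - j)) = x z * a 1 (x(z := 0)) + a 2 (x(z := 0))"
      by (simp add: numeral_2_eq_2)
    then have "V x * G x = (V x * U x) * ((x z)\<^sup>2 + (x z * a 1 (x(z := 0)) + a 2 (x(z := 0))))"
      using elim(1) by simp
    then show ?case using elim(2) by simp
  qed
  note upd = C_fun_upd C_fun_intros
  have t0: "C_fun z (\<lambda>x. a 1 (x(N := 0)))" "C_fun z (\<lambda>x. a 2 (x(N := 0)))" "C_fun (Suc z) (\<lambda>x. V (x(N := 0)))"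
    by (intro C_fun_zero_coord a12 V)+
  \<comment> \<open>At \<open>t = 0\<close> the prepared equation divides zero by \<open>z\<^sup>2 + y\<^sup>2\<close>.\<close>
  have eq0: "\<forall>\<^sub>F x in near_origin (Suc z).
      V (x(N := 0)) * ((x z)\<^sup>2 + (x y)\<^sup>2) = (x z)\<^sup>2 + x z * a 1 (x(N := 0, z := 0)) + a 2 (x(N := 0, z := 0))"
    using eventually_zero_coord[OF eqV, of N] ne by (simp add: G_def)
  have "\<forall>\<^sub>F x in near_origin (Suc z). (V (x(N := 0)) - 1) * ((x z)\<^sup>2 + (x y)\<^sup>2)
      + x z * (- a 1 (x(z := 0, N := 0))) + ((x y)\<^sup>2 - a 2 (x(z := 0, N := 0))) = 0"
    using eq0 by eventually_elim (use ne in \<open>simp add: algebra_simps fun_upd_twist[of z N]\<close>)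
  then have "\<forall>\<^sub>F x in near_origin (Suc z). (\<lambda>x. V (x(N := 0)) - 1) x * ((x z)\<^sup>2 + (x y)\<^sup>2)
      + x z * (\<lambda>x. - a 1 (x(N := 0))) (x(z := 0)) + (\<lambda>x. (x y)\<^sup>2 - a 2 (x(N := 0))) (x(z := 0)) = 0"
    using ne by simp
  note unique = division_unique[OF \<open>y < z\<close> C_fun_minus[OF t0(1)]
    C_fun_diff[OF C_fun_power[OF C_fun_coord] t0(2)] C_fun_diff[OF t0(3) C_fun_const] this]
  have at0: "\<forall>\<^sub>F x in near_origin z. a 1 (x(N := 0)) = 0"
    using unique(1) by eventually_elim (simp add: fun_upd_def)
  have "\<forall>\<^sub>F x in near_origin z. a 2 (x(N := 0)) - ((x(N := 0)) y)\<^sup>2 = 0"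
    using unique(2) by eventually_elim (use ne in \<open>simp add: fun_upd_def\<close>)
  note at0 = at0 this unique(3)
  obtain \<alpha> where alpha: "C_fun z \<alpha>" "\<forall>\<^sub>F x in near_origin z. a 1 x = x N * \<alpha> x"
    using C_fun_divide_coord[OF a12(1) \<open>N < z\<close> at0(1)] .
  obtain \<beta> where beta: "C_fun z \<beta>" "\<forall>\<^sub>F x in near_origin z. a 2 x - (x y)\<^sup>2 = x N * \<beta> x"
    using C_fun_divide_coord[OF C_fun_diff[OF a12(2) C_fun_power[OF C_fun_coord]] \<open>N < z\<close> at0(2)] .
  obtain W where W: "C_fun (Suc z) W" "\<forall>\<^sub>F x in near_origin (Suc z). V x - 1 = x N * W x"
    using C_fun_divide_coord[OF C_fun_diff[OF V(1) C_fun_const] \<open>N < Suc z\<close> at0(3)] .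
  have ab: "C_fun (Suc z) (\<lambda>x. \<alpha> (x(z := 0)))" "C_fun (Suc z) (\<lambda>x. \<beta> (x(z := 0)))"
    by (intro C_fun_lift alpha beta)+
  have "\<forall>\<^sub>F x in near_origin (Suc z).
      x N * (W x * ((x z)\<^sup>2 + (x y)\<^sup>2) + V x * H' x - x z * \<alpha> (x(z := 0)) - \<beta> (x(z := 0))) = 0"
    using eqV eventually_lift[OF alpha(2)] eventually_lift[OF beta(2)] W(2)
  proof eventually_elim
    case (elim x)
    have a2: "a 2 (x(z := 0)) = x N * \<beta> (x(z := 0)) + (x y)\<^sup>2" and V: "V x = 1 + x N * W x"
      using elim ne by (simp_all add: algebra_simps)
    have "V x * (((x z)\<^sup>2 + (x y)\<^sup>2) + x N * H' x)
        = (x z)\<^sup>2 + x z * (x N * \<alpha> (x(z := 0))) + (x N * \<beta> (x(z := 0)) + (x y)\<^sup>2)"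
      using elim ne a2 by (simp add: G_def)
    with V show ?case by algebra
  qed
  then have "\<forall>\<^sub>F x in near_origin (Suc z).
      W x * ((x z)\<^sup>2 + (x y)\<^sup>2) + V x * H' x - x z * \<alpha> (x(z := 0)) - \<beta> (x(z := 0)) = 0"
    by (rule C_fun_cancel_coord[OF _ \<open>N < Suc z\<close>, rotated]) (intro C_fun_intros W V H' ab)
  \<comment> \<open>Put \<open>t = 0\<close> and rename \<open>z\<close> back to the coordinate \<open>N\<close>.\<close>
  then have "\<forall>\<^sub>F x in near_origin (Suc N). (\<lambda>x.
      W x * ((x z)\<^sup>2 + (x y)\<^sup>2) + V x * H' x - x z * \<alpha> (x(z := 0)) - \<beta> (x(z := 0)) = 0) (x(N := 0, z := x N))"
    by (rule eventually_subst) (auto intro!: upd simp: z_def)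
  moreover have "\<forall>\<^sub>F x in near_origin (Suc N). (\<lambda>x. V (x(N := 0)) - 1 = 0) (x(N := 0, z := x N))"
    by (rule eventually_subst[OF at0(3)]) (auto intro!: upd simp: z_def)
  ultimately have "\<forall>\<^sub>F x in near_origin (Suc N).
      H x = - W (x(N := 0, z := x N)) * ((x N)\<^sup>2 + (x y)\<^sup>2) + x N * \<alpha> (x(N := 0)) + \<beta> (x(N := 0))"
    using near_origin_space
  proof eventually_elim
    case (elim x)
    have xz: "x z = 0" using elim(3) z_def by simp
    have "H' (x(N := 0, z := x N)) = H x"
      using xz ne by (simp add: H'_def fun_upd_twist[of N z] fun_upd_idem)
    moreover have "x(N := 0, z := 0) = x(N := 0)" using xz ne by (simp add: fun_upd_idem)
    moreover have "V (x(N := 0, z := x N)) = 1"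
      using elim(2) ne by (simp add: fun_upd_twist[of N z])
    ultimately show ?case using elim(1) ne by simp
  qed
  moreover have "C_fun N \<alpha>" "C_fun N \<beta>"
    by (rule C_fun_subst[OF alpha(1), of N "\<lambda>x. x"] C_fun_subst[OF beta(1), of N "\<lambda>x. x"];
        use ne in \<open>auto intro!: upd\<close>)+
  moreover have "C_fun (Suc N) (\<lambda>x. - W (x(N := 0, z := x N)))"
    by (intro C_fun_minus C_fun_subst[OF W(1)]) (auto intro!: upd simp: z_def)
  ultimately show ?thesis using that by blast
qed

end

section \<open>Holomorphic extension in one variable\<close>

lemma has_derivative_of_partials:
  fixes f f1 f2 :: "real \<Rightarrow> real \<Rightarrow> real"
  assumes f1: "\<And>s y. \<bar>s\<bar> < r \<Longrightarrow> \<bar>y\<bar> < r \<Longrightarrow> ((\<lambda>s. f s y) has_real_derivative f1 s y) (at s)"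
    and f2: "\<And>s y. \<bar>s\<bar> < r \<Longrightarrow> \<bar>y\<bar> < r \<Longrightarrow> ((\<lambda>y. f s y) has_real_derivative f2 s y) (at y)"
    and cont: "continuous_on ({-r<..<r} \<times> {-r<..<r}) (\<lambda>(s, y). f2 s y)"
    and "\<bar>s\<bar> < r" "\<bar>y\<bar> < r"
  shows "((\<lambda>(s, y). f s y) has_derivative (\<lambda>(a, b). f1 s y * a + f2 s y * b)) (at (s, y))"
proof -
  let ?X = "{-r<..<r}"
  have sy: "s \<in> ?X" "y \<in> ?X" "(s, y) \<in> ?X \<times> ?X" using assms(4,5) by auto
  have "((\<lambda>(s, y). f s y) has_derivative
      (\<lambda>(a, b). f1 s y * a + blinfun_apply (blinfun_scaleR_right (f2 s y)) b)) (at (s, y) within ?X \<times> ?X)"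
  proof (rule has_derivative_partialsI)
    show "((\<lambda>s. f s y) has_derivative (*) (f1 s y)) (at s within ?X)"
      using f1[OF assms(4,5)] unfolding has_field_derivative_def by (rule has_derivative_at_withinI)
    show "(f s has_derivative blinfun_apply (blinfun_scaleR_right (f2 s y))) (at y within ?X)"
      if "s \<in> ?X" "y \<in> ?X" for s y
    proof -
      have "((*\<^sub>R) (f2 s y)) = (*) (f2 s y)" by (simp add: fun_eq_iff)
      then show ?thesis
        using f2[of s y, THEN has_field_derivative_imp_has_derivative, THEN has_derivative_at_withinI] that
        by (simp add: abs_less_iff)
    qed
    have "continuous (at (s, y) within ?X \<times> ?X) (\<lambda>(s, y). f2 s y)"
      using cont sy(3) unfolding continuous_on_eq_continuous_within by (rule bspec)
    then have "continuous (at (s, y) within ?X \<times> ?X)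
        (\<lambda>p. blinfun_scaleR_right ((\<lambda>(s, y). f2 s y) p) :: real \<Rightarrow>\<^sub>L real)"
      by (rule bounded_linear.continuous[OF bounded_linear_blinfun_scaleR_right])
    then show "continuous (at (s, y) within ?X \<times> ?X)
        (\<lambda>(s, y). blinfun_scaleR_right (f2 s y) :: real \<Rightarrow>\<^sub>L real)"
      by (simp add: case_prod_beta')
  qed (use sy in auto)
  moreover have "at (s, y) within ?X \<times> ?X = at (s, y)"
    by (rule at_within_open[OF sy(3)]) (intro open_Times open_greaterThanLessThan)
  ultimately show ?thesis
    by (simp only: blinfun_scaleR_right.rep_eq real_scaleR_def)
qed

lemma Cauchy_Riemann_holomorphic:
  fixes u v u1 u2 v1 v2 :: "real \<Rightarrow> real \<Rightarrow> real"
  assumes u1: "\<And>s y. \<bar>s\<bar> < r \<Longrightarrow> \<bar>y\<bar> < r \<Longrightarrow> ((\<lambda>s. u s y) has_real_derivative u1 s y) (at s)"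
    and u2: "\<And>s y. \<bar>s\<bar> < r \<Longrightarrow> \<bar>y\<bar> < r \<Longrightarrow> ((\<lambda>y. u s y) has_real_derivative u2 s y) (at y)"
    and v1: "\<And>s y. \<bar>s\<bar> < r \<Longrightarrow> \<bar>y\<bar> < r \<Longrightarrow> ((\<lambda>s. v s y) has_real_derivative v1 s y) (at s)"
    and v2: "\<And>s y. \<bar>s\<bar> < r \<Longrightarrow> \<bar>y\<bar> < r \<Longrightarrow> ((\<lambda>y. v s y) has_real_derivative v2 s y) (at y)"
    and cont: "continuous_on ({-r<..<r} \<times> {-r<..<r}) (\<lambda>(s, y). u2 s y)"
      "continuous_on ({-r<..<r} \<times> {-r<..<r}) (\<lambda>(s, y). v2 s y)"
    and CR: "\<And>s y. \<bar>s\<bar> < r \<Longrightarrow> \<bar>y\<bar> < r \<Longrightarrow> v2 s y = u1 s y"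
      "\<And>s y. \<bar>s\<bar> < r \<Longrightarrow> \<bar>y\<bar> < r \<Longrightarrow> u2 s y = - v1 s y"
  shows "(\<lambda>w. Complex (u (Re w) (Im w)) (v (Re w) (Im w))) holomorphic_on ball 0 r"
proof (rule holomorphic_onI, rule field_differentiable_at_within)
  fix w :: complex assume "w \<in> ball 0 r"
  then have w: "\<bar>Re w\<bar> < r" "\<bar>Im w\<bar> < r"
    using abs_Re_le_cmod[of w] abs_Im_le_cmod[of w] by auto
  have ri: "((\<lambda>w. (Re w, Im w)) has_derivative (\<lambda>h. (Re h, Im h))) (at w)"
    by (intro has_derivative_Pair bounded_linear_imp_has_derivative bounded_linear_Re bounded_linear_Im)
  have du: "((\<lambda>w. u (Re w) (Im w)) has_derivative (\<lambda>h. u1 (Re w) (Im w) * Re h + u2 (Re w) (Im w) * Im h)) (at w)"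
    using has_derivative_compose[OF ri has_derivative_of_partials[OF u1 u2 cont(1) w]] by simp
  have dv: "((\<lambda>w. v (Re w) (Im w)) has_derivative (\<lambda>h. v1 (Re w) (Im w) * Re h + v2 (Re w) (Im w) * Im h)) (at w)"
    using has_derivative_compose[OF ri has_derivative_of_partials[OF v1 v2 cont(2) w]] by simp
  have "((\<lambda>w. complex_of_real (u (Re w) (Im w)) + \<i> * complex_of_real (v (Re w) (Im w))) has_derivative
      (\<lambda>h. complex_of_real (u1 (Re w) (Im w) * Re h + u2 (Re w) (Im w) * Im h)
        + \<i> * complex_of_real (v1 (Re w) (Im w) * Re h + v2 (Re w) (Im w) * Im h))) (at w)"
    by (rule has_derivative_add[OF has_derivative_of_real[OF du]
          has_derivative_mult_right[OF has_derivative_of_real[OF dv]]])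
  moreover have "(\<lambda>h. complex_of_real (u1 (Re w) (Im w) * Re h + u2 (Re w) (Im w) * Im h)
        + \<i> * complex_of_real (v1 (Re w) (Im w) * Re h + v2 (Re w) (Im w) * Im h))
      = (*) (Complex (u1 (Re w) (Im w)) (v1 (Re w) (Im w)))"
    by (rule ext) (simp add: complex_eq_iff CR[OF w])
  moreover have "(\<lambda>w. complex_of_real (u (Re w) (Im w)) + \<i> * complex_of_real (v (Re w) (Im w)))
      = (\<lambda>w. Complex (u (Re w) (Im w)) (v (Re w) (Im w)))"
    by (rule ext) (simp add: complex_eq_iff)
  ultimately have "((\<lambda>w. Complex (u (Re w) (Im w)) (v (Re w) (Im w))) has_derivative
      (*) (Complex (u1 (Re w) (Im w)) (v1 (Re w) (Im w)))) (at w)"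
    by simp
  then show "(\<lambda>w. Complex (u (Re w) (Im w)) (v (Re w) (Im w))) field_differentiable at w"
    unfolding field_differentiable_def has_field_derivative_def by blast
qed

context quasianalytic_system
begin

lemma C_fun_bounded:
  assumes "C_fun n f"
  obtains M where "\<forall>\<^sub>F x in near_origin n. \<bar>f x\<bar> \<le> M"
proof
  have "\<forall>\<^sub>F x in near_origin n. dist (f x) (f origin) < 1"
    using tendstoD[OF C_fun_tendsto[OF assms], of 1] by simp
  then show "\<forall>\<^sub>F x in near_origin n. \<bar>f x\<bar> \<le> \<bar>f origin\<bar> + 1"
  proof eventually_elim
    case (elim x)
    then show ?case unfolding dist_real_def by linarith
  qed
qed

text \<open>
  Write \<open>E\<close> for the divided function. It depends on \<open>s\<close> and \<open>z\<close> only through \<open>s + z\<close> and not at all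
  on \<open>y\<close>, so \<open>\<partial>E/\<partial>s = \<partial>E/\<partial>z\<close> and \<open>\<partial>E/\<partial>y = 0\<close>. Applied to the right-hand side of the division these two
  identities contain \<open>Q\<close> outside multiples of \<open>z\<^sup>2 + y\<^sup>2\<close> as \<open>- 2 z Q\<close> and \<open>2 y Q\<close>. Multiplying them by
  \<open>y\<close> and \<open>z\<close> and adding eliminates \<open>Q\<close>; what remains is again a division of zero by \<open>z\<^sup>2 + y\<^sup>2\<close>, whose
  remainder must vanish. The conclusion is the system of Cauchy-Riemann equations for
  \<open>\<beta> + \<i> y \<alpha>\<close> in the variable \<open>s + \<i> y\<close>.
\<close>

lemma division_Cauchy_Riemann:
  assumes "C_fun (Suc n) h"
    and ab: "C_fun (Suc (Suc n)) \<alpha>" "C_fun (Suc (Suc n)) \<beta>"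
    and Q: "C_fun (Suc (Suc (Suc n))) Q"
    and s: "s = n" and y: "y = Suc n" and z: "z = Suc (Suc n)"
    and eq: "\<forall>\<^sub>F x in near_origin (Suc z). h (x(s := x s + x z, y := 0, z := 0))
      = Q x * ((x z)\<^sup>2 + (x y)\<^sup>2) + x z * \<alpha> (x(z := 0)) + \<beta> (x(z := 0))"
  shows "\<forall>\<^sub>F x in near_origin z. partial_deriv y \<beta> x = - (x y * partial_deriv s \<alpha> x)"
    and "\<forall>\<^sub>F x in near_origin z. partial_deriv s \<beta> x = \<alpha> x + x y * partial_deriv y \<alpha> x"
proof -
  have ne: "s < z" "y < z" "s < Suc z" "y < Suc z" "z < Suc z" "s \<noteq> y" "y \<noteq> s" "s \<noteq> z" "z \<noteq> s" "y \<noteq> z" "z \<noteq> y"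
    by (auto simp: s y z)
  note ab = ab[folded z] and Q = Q[folded z]
  define H where "H = (\<lambda>x. h (x(s := x s + x z, y := 0, z := 0)))"
  define R where "R = (\<lambda>x. Q x * ((x z)\<^sup>2 + (x y)\<^sup>2) + x z * \<alpha> (x(z := 0)) + \<beta> (x(z := 0)))"
  have H: "C_fun (Suc z) H"
    unfolding H_def
    by (rule C_fun_subst[OF assms(1)]) (auto simp: s y z intro!: C_fun_upd C_fun_intros)
  have HR: "\<forall>\<^sub>F x in near_origin (Suc z). H x = R x"
    using eq by (simp add: H_def R_def)
  note dHR = partial_deriv_eventually_cong[OF HR]
  note d\<alpha> = eventually_lift[OF C_fun_has_partial_deriv[OF ab(1)]]
  note d\<beta> = eventually_lift[OF C_fun_has_partial_deriv[OF ab(2)]]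
  note dQ = C_fun_has_partial_deriv[OF Q]
  let ?D = "\<lambda>x. (x z)\<^sup>2 + (x y)\<^sup>2"
  have Rs: "\<forall>\<^sub>F x in near_origin (Suc z). partial_deriv s R x
      = partial_deriv s Q x * ?D x + x z * partial_deriv s \<alpha> (x(z := 0)) + partial_deriv s \<beta> (x(z := 0))"
    using d\<alpha>[OF ne(1)] d\<beta>[OF ne(1)] dQ[OF ne(3)]
  proof eventually_elim
    case (elim x)
    have "((\<lambda>u. \<alpha> (x(s := u, z := 0))) has_real_derivative partial_deriv s \<alpha> (x(z := 0))) (at (x s))"
      "((\<lambda>u. \<beta> (x(s := u, z := 0))) has_real_derivative partial_deriv s \<beta> (x(z := 0))) (at (x s))"
      using elim(1,2) ne by (simp_all add: fun_upd_twist[OF \<open>z \<noteq> s\<close>])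
    then have "((\<lambda>u. R (x(s := u))) has_real_derivative partial_deriv s Q x * ?D x
        + x z * partial_deriv s \<alpha> (x(z := 0)) + partial_deriv s \<beta> (x(z := 0))) (at (x s))"
      unfolding R_def using elim(3) ne by (auto intro!: derivative_eq_intros)
    then show ?case by (simp add: partial_deriv_def[of s R] DERIV_imp_deriv)
  qed
  have Ry: "\<forall>\<^sub>F x in near_origin (Suc z). partial_deriv y R x
      = partial_deriv y Q x * ?D x + 2 * x y * Q x + x z * partial_deriv y \<alpha> (x(z := 0)) + partial_deriv y \<beta> (x(z := 0))"
    using d\<alpha>[OF ne(2)] d\<beta>[OF ne(2)] dQ[OF ne(4)]
  proof eventually_elim
    case (elim x)
    have "((\<lambda>u. \<alpha> (x(y := u, z := 0))) has_real_derivative partial_deriv y \<alpha> (x(z := 0))) (at (x y))"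
      "((\<lambda>u. \<beta> (x(y := u, z := 0))) has_real_derivative partial_deriv y \<beta> (x(z := 0))) (at (x y))"
      using elim(1,2) ne by (simp_all add: fun_upd_twist[OF \<open>z \<noteq> y\<close>])
    then have "((\<lambda>u. R (x(y := u))) has_real_derivative partial_deriv y Q x * ?D x + 2 * x y * Q x
        + x z * partial_deriv y \<alpha> (x(z := 0)) + partial_deriv y \<beta> (x(z := 0))) (at (x y))"
      unfolding R_def using elim(3) ne by (auto intro!: derivative_eq_intros)
    then show ?case by (simp add: partial_deriv_def[of y R] DERIV_imp_deriv)
  qed
  have Rz: "\<forall>\<^sub>F x in near_origin (Suc z). partial_deriv z R x
      = partial_deriv z Q x * ?D x + 2 * x z * Q x + \<alpha> (x(z := 0))"
    using dQ[OF ne(5)]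
  proof eventually_elim
    case (elim x)
    have "((\<lambda>u. R (x(z := u))) has_real_derivative
        partial_deriv z Q x * ?D x + 2 * x z * Q x + \<alpha> (x(z := 0))) (at (x z))"
      unfolding R_def using elim ne by (auto intro!: derivative_eq_intros)
    then show ?case by (simp add: partial_deriv_def[of z R] DERIV_imp_deriv)
  qed
  have Hy: "partial_deriv y H x = 0" for x
    unfolding partial_deriv_def H_def using ne by (simp add: fun_upd_twist[OF \<open>y \<noteq> s\<close>])
  have Hsz: "\<forall>\<^sub>F x in near_origin (Suc z). partial_deriv s H x = partial_deriv z H x"
    using C_fun_has_partial_deriv[OF H ne(3)]
  proof eventually_elim
    case (elim x)
    define k where "k = (\<lambda>u. h (x(s := u, y := 0, z := 0)))"
    have 1: "(\<lambda>u. H (x(s := u))) = (\<lambda>u. k (u + x z))"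
      using ne by (simp add: H_def k_def)
    have 2: "(\<lambda>u. H (x(z := u))) = (\<lambda>u. k (u + x s))"
      using ne by (simp add: H_def k_def fun_upd_twist[of z] add.commute)
    have "(k has_real_derivative partial_deriv s H x) (at (x s + x z))"
      using elim unfolding 1 by (simp add: DERIV_shift)
    then have "((\<lambda>u. H (x(z := u))) has_real_derivative partial_deriv s H x) (at (x z))"
      unfolding 2 by (simp add: DERIV_shift[symmetric] add.commute)
    then show ?case by (simp add: partial_deriv_def[of z] DERIV_imp_deriv)
  qed
  define B where "B = (\<lambda>x. x y * partial_deriv s Q x - x y * partial_deriv z Q x
      + x z * partial_deriv y Q x + partial_deriv y \<alpha> (x(z := 0)))"
  define p where "p = (\<lambda>x. x y * partial_deriv s \<alpha> x + partial_deriv y \<beta> x)"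
  define q where "q = (\<lambda>x. x y * (partial_deriv s \<beta> x - \<alpha> x - x y * partial_deriv y \<alpha> x))"
  have r: "C_fun z (\<lambda>x. partial_deriv s \<beta> x - \<alpha> x - x y * partial_deriv y \<alpha> x)"
    by (intro C_fun_intros C_fun_partial_deriv ab ne)
  have "C_fun z p" "C_fun z q" "C_fun (Suc z) B"
    unfolding p_def q_def B_def
    by (intro C_fun_intros C_fun_partial_deriv ab ne C_fun_lift Q)+
  moreover have "\<forall>\<^sub>F x in near_origin (Suc z). B x * ?D x + x z * p (x(z := 0)) + q (x(z := 0)) = 0"
    using Rs Ry Rz Hsz dHR[OF ne(3)] dHR[OF ne(4)] dHR[OF ne(5)]
  proof eventually_elim
    case (elim x)
    define As Ay Bs By Q0 Qs Qy Qz a0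
      where "As = partial_deriv s \<alpha> (x(z := 0))" and "Ay = partial_deriv y \<alpha> (x(z := 0))"
        and "Bs = partial_deriv s \<beta> (x(z := 0))" and "By = partial_deriv y \<beta> (x(z := 0))"
        and "Q0 = Q x" and "Qs = partial_deriv s Q x" and "Qy = partial_deriv y Q x"
        and "Qz = partial_deriv z Q x" and "a0 = \<alpha> (x(z := 0))"
    note defs = this
    have "Qs * ?D x + x z * As + Bs = Qz * ?D x + 2 * x z * Q0 + a0"
      using elim by (simp add: defs)
    moreover have "Qy * ?D x + 2 * x y * Q0 + x z * Ay + By = 0"
      using elim Hy[of x] by (simp add: defs)
    ultimately have "(x y * Qs - x y * Qz + x z * Qy + Ay) * ?D x + x z * (x y * As + By)
        + x y * (Bs - a0 - x y * Ay) = 0"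
      by algebra
    then show ?case
      using ne by (simp add: B_def p_def q_def defs)
  qed
  ultimately have p: "\<forall>\<^sub>F x in near_origin z. p x = 0" and q: "\<forall>\<^sub>F x in near_origin z. q x = 0"
    using division_unique(1,2)[OF ne(2)] by blast+
  show "\<forall>\<^sub>F x in near_origin z. partial_deriv y \<beta> x = - (x y * partial_deriv s \<alpha> x)"
    using p by eventually_elim (simp add: p_def)
  show "\<forall>\<^sub>F x in near_origin z. partial_deriv s \<beta> x = \<alpha> x + x y * partial_deriv y \<alpha> x"
    using C_fun_cancel_coord[OF r ne(2) q[unfolded q_def]] by eventually_elim simp
qed

end

context quasianalytic_system
begin

text \<open>
  The radius \<open>\<delta>\<close> and the bound \<open>M\<close> do not depend on the parameter \<open>\<theta>\<close>: \<open>\<alpha>\<close> and \<open>\<beta>\<close> are germs in all variables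
  \<open>\<theta>, s, y\<close> jointly.
\<close>

lemma complex_extension:
  assumes "weierstrass_preparation C" "C_fun (Suc n) h"
  shows "\<exists>\<delta> M. \<exists>F :: point \<Rightarrow> complex \<Rightarrow> complex. \<delta> > 0 \<and> (\<forall>\<theta>\<in>cube n \<delta>.
    F \<theta> holomorphic_on ball 0 \<delta> \<and> (\<forall>w\<in>ball 0 \<delta>. cmod (F \<theta> w) \<le> M) \<and>
    (\<forall>u. \<bar>u\<bar> < \<delta> \<longrightarrow> F \<theta> (complex_of_real u) = complex_of_real (h (\<theta>(n := u)))))"
proof -
  define s y z where "s = n" and "y = Suc n" and "z = Suc (Suc n)"
  note syz = this
  have ne: "s < z" "y < z" "s < Suc z" "y < Suc z" "s \<noteq> y" "y \<noteq> s" "s \<noteq> z" "z \<noteq> s" "y \<noteq> z" "z \<noteq> y"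
    by (auto simp: syz)
  have H: "C_fun (Suc z) (\<lambda>x. h (x(s := x s + x z, y := 0, z := 0)))"
    by (rule C_fun_subst[OF assms(2)]) (auto simp: syz intro!: C_fun_upd C_fun_intros)
  obtain \<alpha> \<beta> Q where ab: "C_fun z \<alpha>" "C_fun z \<beta>" and Q: "C_fun (Suc z) Q"
    and eq: "\<forall>\<^sub>F x in near_origin (Suc z). h (x(s := x s + x z, y := 0, z := 0))
      = Q x * ((x z)\<^sup>2 + (x y)\<^sup>2) + x z * \<alpha> (x(z := 0)) + \<beta> (x(z := 0))"
    using weierstrass_division[OF assms(1) ne(2) H] .
  note CR = division_Cauchy_Riemann[OF assms(2) ab[unfolded syz] Q[unfolded syz] syz(1-3) eq]
  have real: "\<forall>\<^sub>F x in near_origin z. h (x(y := 0)) = \<beta> (x(y := 0))"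
    using near_origin_SucD[OF eventually_zero_coord[OF eventually_zero_coord[OF eq, of y], of z]]
      near_origin_space
  proof eventually_elim
    case (elim x)
    then have "x(z := 0) = x" by (simp add: fun_upd_idem)
    moreover have "(x(y := 0))(z := 0) = x(y := 0)" "(x(y := 0))(s := x s) = x(y := 0)"
      using elim(2) ne by (simp_all add: fun_upd_idem)
    moreover have "x z = 0" using elim(2) by simp
    ultimately show ?case using elim(1) ne by (simp add: fun_upd_twist[of s y])
  qed
  obtain Ma where Ma: "\<forall>\<^sub>F x in near_origin z. \<bar>\<alpha> x\<bar> \<le> Ma" using C_fun_bounded[OF ab(1)] .
  obtain Mb where Mb: "\<forall>\<^sub>F x in near_origin z. \<bar>\<beta> x\<bar> \<le> Mb" using C_fun_bounded[OF ab(2)] .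
  note pd = C_fun_has_partial_deriv[OF ab(1) ne(1)] C_fun_has_partial_deriv[OF ab(1) ne(2)]
    C_fun_has_partial_deriv[OF ab(2) ne(1)] C_fun_has_partial_deriv[OF ab(2) ne(2)]
  \<comment> \<open>Everything that is needed at a single point, so that one cube serves all facts.\<close>
  define good where "good = (\<lambda>x.
      partial_deriv y \<beta> x = - (x y * partial_deriv s \<alpha> x)
    \<and> partial_deriv s \<beta> x = \<alpha> x + x y * partial_deriv y \<alpha> x
    \<and> h (x(y := 0)) = \<beta> (x(y := 0)) \<and> \<bar>\<alpha> x\<bar> \<le> Ma \<and> \<bar>\<beta> x\<bar> \<le> Mb
    \<and> ((\<lambda>u. \<alpha> (x(s := u))) has_real_derivative partial_deriv s \<alpha> x) (at (x s))
    \<and> ((\<lambda>u. \<alpha> (x(y := u))) has_real_derivative partial_deriv y \<alpha> x) (at (x y))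
    \<and> ((\<lambda>u. \<beta> (x(s := u))) has_real_derivative partial_deriv s \<beta> x) (at (x s))
    \<and> ((\<lambda>u. \<beta> (x(y := u))) has_real_derivative partial_deriv y \<beta> x) (at (x y)))"
  have "\<forall>\<^sub>F x in near_origin z. good x"
    using CR[folded syz] real Ma Mb pd by eventually_elim (simp add: good_def)
  then obtain d0 where d0: "d0 > 0" "\<And>x. x \<in> cube z d0 \<Longrightarrow> good x"
    using eventually_near_originE by blast
  obtain d1 where d1: "d1 > 0" "continuous_on (cube z d1) \<alpha>"
    using C_fun_continuous[OF ab(1)] .
  obtain d2 where d2: "d2 > 0" "continuous_on (cube z d2) (partial_deriv y \<alpha>)"
    using C_fun_continuous[OF C_fun_partial_deriv[OF ab(1) ne(2)]] .
  obtain d3 where d3: "d3 > 0" "continuous_on (cube z d3) (partial_deriv y \<beta>)"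
    using C_fun_continuous[OF C_fun_partial_deriv[OF ab(2) ne(2)]] .
  define \<delta> where "\<delta> = Min {d0, d1, d2, d3, 1}"
  have "\<delta> > 0" using d0 d1 d2 d3 by (simp add: \<delta>_def)
  have le: "\<delta> \<le> d0" "\<delta> \<le> d1" "\<delta> \<le> d2" "\<delta> \<le> d3" "\<delta> \<le> 1" by (simp_all add: \<delta>_def)
  note cont = continuous_on_subset[OF d1(2) cube_mono[OF le(2)]]
    continuous_on_subset[OF d2(2) cube_mono[OF le(3)]]
    continuous_on_subset[OF d3(2) cube_mono[OF le(4)]]
  have good: "good x" if "x \<in> cube z \<delta>" for x
    using d0(2) cube_mono[OF le(1)] that by blast
  define pt where "pt = (\<lambda>\<theta> a b. \<theta>(s := a, y := b) :: point)"
  have pt_simps: "pt \<theta> a b s = a" "pt \<theta> a b y = b" "(pt \<theta> a b)(s := u) = pt \<theta> u b"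
    "(pt \<theta> a b)(y := u) = pt \<theta> a u" for \<theta> a b u
    using ne by (simp_all add: pt_def fun_upd_twist[of y s])
  have pt_cube: "pt \<theta> a b \<in> cube z \<delta>" if "\<theta> \<in> cube n \<delta>" "\<bar>a\<bar> < \<delta>" "\<bar>b\<bar> < \<delta>" for \<theta> a b
    using that by (auto simp: pt_def cube_def syz less_Suc_eq)
  define F where "F = (\<lambda>\<theta> w. Complex (\<beta> (pt \<theta> (Re w) (Im w))) (Im w * \<alpha> (pt \<theta> (Re w) (Im w))))"
  have contF: "continuous_on ({-\<delta><..<\<delta>} \<times> {-\<delta><..<\<delta>}) (\<lambda>p. g (pt \<theta> (fst p) (snd p)))"
    if "continuous_on (cube z \<delta>) g" "\<theta> \<in> cube n \<delta>" for g :: "point \<Rightarrow> real" and \<theta>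
  proof (rule continuous_on_compose2[OF that(1)])
    have "continuous_on A (\<lambda>p. ((\<theta>(s := fst p)) j))" for A and j
      by (cases "j = s") (simp_all add: continuous_on_fst continuous_on_id)
    then show "continuous_on ({-\<delta><..<\<delta>} \<times> {-\<delta><..<\<delta>}) (\<lambda>p. pt \<theta> (fst p) (snd p))"
      unfolding pt_def by (intro continuous_on_fun_upd continuous_on_snd continuous_on_id)
    show "(\<lambda>p. pt \<theta> (fst p) (snd p)) ` ({-\<delta><..<\<delta>} \<times> {-\<delta><..<\<delta>}) \<subseteq> cube z \<delta>"
      using pt_cube[OF that(2)] by (auto simp: abs_less_iff)
  qed
  show ?thesis
  proof (rule exI[of _ \<delta>], rule exI[of _ "Mb + Ma"], rule exI[of _ F], intro conjI ballI allI impI)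
    show "\<delta> > 0" by fact
  next
    fix \<theta> assume th: "\<theta> \<in> cube n \<delta>"
    show "F \<theta> holomorphic_on ball 0 \<delta>"
      unfolding F_def
    proof (rule Cauchy_Riemann_holomorphic[of \<delta> "\<lambda>a b. \<beta> (pt \<theta> a b)"
        "\<lambda>a b. partial_deriv s \<beta> (pt \<theta> a b)" "\<lambda>a b. partial_deriv y \<beta> (pt \<theta> a b)"
        "\<lambda>a b. b * \<alpha> (pt \<theta> a b)" "\<lambda>a b. b * partial_deriv s \<alpha> (pt \<theta> a b)"
        "\<lambda>a b. \<alpha> (pt \<theta> a b) + b * partial_deriv y \<alpha> (pt \<theta> a b)"])
      fix a b :: real assume ab: "\<bar>a\<bar> < \<delta>" "\<bar>b\<bar> < \<delta>"
      have g: "good (pt \<theta> a b)" by (rule good[OF pt_cube[OF th ab]])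
      have D: "((\<lambda>u. \<alpha> (pt \<theta> u b)) has_real_derivative partial_deriv s \<alpha> (pt \<theta> a b)) (at a)"
        "((\<lambda>u. \<alpha> (pt \<theta> a u)) has_real_derivative partial_deriv y \<alpha> (pt \<theta> a b)) (at b)"
        "((\<lambda>u. \<beta> (pt \<theta> u b)) has_real_derivative partial_deriv s \<beta> (pt \<theta> a b)) (at a)"
        "((\<lambda>u. \<beta> (pt \<theta> a u)) has_real_derivative partial_deriv y \<beta> (pt \<theta> a b)) (at b)"
        using g[unfolded good_def pt_simps] by blast+
      show "((\<lambda>a. \<beta> (pt \<theta> a b)) has_real_derivative partial_deriv s \<beta> (pt \<theta> a b)) (at a)"
        "((\<lambda>b. \<beta> (pt \<theta> a b)) has_real_derivative partial_deriv y \<beta> (pt \<theta> a b)) (at b)"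
        by (rule D)+
      show "((\<lambda>a. b * \<alpha> (pt \<theta> a b)) has_real_derivative b * partial_deriv s \<alpha> (pt \<theta> a b)) (at a)"
        by (rule DERIV_cmult[OF D(1)])
      show "((\<lambda>b. b * \<alpha> (pt \<theta> a b)) has_real_derivative
          \<alpha> (pt \<theta> a b) + b * partial_deriv y \<alpha> (pt \<theta> a b)) (at b)"
        using DERIV_mult[OF DERIV_ident D(2)] by (simp add: algebra_simps)
      show "\<alpha> (pt \<theta> a b) + b * partial_deriv y \<alpha> (pt \<theta> a b) = partial_deriv s \<beta> (pt \<theta> a b)"
        "partial_deriv y \<beta> (pt \<theta> a b) = - (b * partial_deriv s \<alpha> (pt \<theta> a b))"
        using g[unfolded good_def pt_simps] by simp_all
    next
      show "continuous_on ({-\<delta><..<\<delta>} \<times> {-\<delta><..<\<delta>}) (\<lambda>(a, b). partial_deriv y \<beta> (pt \<theta> a b))"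
        using contF[OF cont(3) th] by (simp add: case_prod_beta')
      show "continuous_on ({-\<delta><..<\<delta>} \<times> {-\<delta><..<\<delta>})
          (\<lambda>(a, b). \<alpha> (pt \<theta> a b) + b * partial_deriv y \<alpha> (pt \<theta> a b))"
        unfolding case_prod_beta'
        by (rule continuous_on_add[OF contF[OF cont(1) th]
              continuous_on_mult[OF continuous_on_snd[OF continuous_on_id] contF[OF cont(2) th]]])
    qed
    show "cmod (F \<theta> w) \<le> Mb + Ma" if "w \<in> ball 0 \<delta>" for w
    proof -
      have w: "\<bar>Re w\<bar> < \<delta>" "\<bar>Im w\<bar> < \<delta>"
        using that abs_Re_le_cmod[of w] abs_Im_le_cmod[of w] by auto
      have g: "good (pt \<theta> (Re w) (Im w))" by (rule good[OF pt_cube[OF th w]])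
      have "cmod (F \<theta> w) \<le> \<bar>\<beta> (pt \<theta> (Re w) (Im w))\<bar> + \<bar>Im w\<bar> * \<bar>\<alpha> (pt \<theta> (Re w) (Im w))\<bar>"
        using cmod_le[of "F \<theta> w"] by (simp add: F_def abs_mult)
      moreover have "\<bar>Im w\<bar> * \<bar>\<alpha> (pt \<theta> (Re w) (Im w))\<bar> \<le> 1 * Ma"
        by (rule mult_mono) (use w le(5) g in \<open>auto simp: good_def\<close>)
      ultimately show ?thesis using g by (auto simp: good_def)
    qed
    show "F \<theta> (complex_of_real u) = complex_of_real (h (\<theta>(n := u)))" if u: "\<bar>u\<bar> < \<delta>" for u
    proof -
      have "good (pt \<theta> u 0)" by (rule good[OF pt_cube[OF th u]]) (use \<open>\<delta> > 0\<close> in simp)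
      then have "h (pt \<theta> u 0) = \<beta> (pt \<theta> u 0)" by (simp add: good_def pt_simps)
      moreover have "pt \<theta> u 0 = \<theta>(n := u)"
        using cubeD(2)[OF th, of y] ne by (simp add: pt_def syz(1) fun_upd_idem) (simp add: syz fun_upd_idem)
      ultimately show ?thesis by (simp add: F_def complex_eq_iff)
    qed
  qed
qed

end

section \<open>Taylor expansion along rays\<close>

text \<open>
  Homogeneous polynomials of degree \<open>k\<close> are written as sums over words in the variables, that is,
  over monomials in non-commuting variables. Iterated Hadamard division produces the terms in this
  form, and no symmetry of the coefficients has to be proved.
\<close>

definition words :: "nat \<Rightarrow> nat \<Rightarrow> nat list set" where
  "words n k = {w. set w \<subseteq> {..<n} \<and> length w = k}"

definition word_form :: "nat \<Rightarrow> (nat list \<Rightarrow> real) \<Rightarrow> nat \<Rightarrow> point \<Rightarrow> real" where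
  "word_form n c k x = (\<Sum>w\<in>words n k. c w * prod_list (map x w))"

lemma words_0: "words n 0 = {[]}"
  by (auto simp: words_def)

lemma finite_words: "finite (words n k)"
  unfolding words_def by (rule finite_lists_length_eq) simp

lemma sum_words_Suc:
  fixes g :: "nat list \<Rightarrow> real"
  shows "(\<Sum>w\<in>words n (Suc k). g w) = (\<Sum>w\<in>words n k. \<Sum>i<n. g (i # w))"
proof -
  have "words n (Suc k) = (\<lambda>(w, i). i # w) ` (words n k \<times> {..<n})"
    by (force simp: words_def length_Suc_conv image_iff)
  moreover have "inj_on (\<lambda>(w, i). i # w) (words n k \<times> {..<n})"
    by (auto simp: inj_on_def)
  ultimately show ?thesis
    by (simp add: sum.reindex sum.cartesian_product case_prod_beta')
qed

lemma prod_list_scale: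
  "prod_list (map (\<lambda>i. u * \<theta> i) w) = u ^ length w * prod_list (map \<theta> w)" for u :: real
  by (induction w) (auto simp: algebra_simps)

lemma word_form_scale: "word_form n c k (\<lambda>i. u * \<theta> i) = word_form n c k \<theta> * u ^ k"
  unfolding word_form_def prod_list_scale sum_distrib_right
  by (intro sum.cong) (auto simp: words_def)

context quasianalytic_system
begin

text \<open>
  Set the coordinates to zero one after the other; each difference is divisible by the coordinate.
\<close>

lemma Hadamard_expansion:
  assumes "C_fun n f"
  shows "\<exists>g. (\<forall>i<n. C_fun n (g i)) \<and>
    (\<forall>\<^sub>F x in near_origin n. f x = f origin + (\<Sum>i<n. x i * g i x))"
proof -
  \<comment> \<open>\<open>tr m\<close> sets the first \<open>m\<close> coordinates to zero.\<close>
  define tr where "tr = (\<lambda>m (x::point) i. if i < m then 0 else x i)"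
  have C_tr: "C_fun n (\<lambda>x. f (tr m x))" for m
    by (rule C_fun_subst[OF assms]) (auto simp: tr_def intro!: C_fun_intros)
  have "\<exists>g. (\<forall>i<m. C_fun n (g i)) \<and> (\<forall>\<^sub>F x in near_origin n. f x = f (tr m x) + (\<Sum>i<m. x i * g i x))"
    if "m \<le> n" for m
    using that
  proof (induction m)
    case 0
    show ?case by (auto simp: tr_def)
  next
    case (Suc m)
    then obtain g where g: "\<forall>i<m. C_fun n (g i)"
      "\<forall>\<^sub>F x in near_origin n. f x = f (tr m x) + (\<Sum>i<m. x i * g i x)"
      by auto
    have "tr m (x(m := 0)) = tr (Suc m) (x(m := 0))" for x
      by (auto simp: tr_def fun_eq_iff)
    then have "\<forall>\<^sub>F x in near_origin n. f (tr m (x(m := 0))) - f (tr (Suc m) (x(m := 0))) = 0"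
      by simp
    then obtain gm where gm: "C_fun n gm"
      "\<forall>\<^sub>F x in near_origin n. f (tr m x) - f (tr (Suc m) x) = x m * gm x"
      using C_fun_divide_coord[OF C_fun_diff[OF C_tr C_tr], of m m "Suc m"] Suc.prems by auto
    have "\<forall>\<^sub>F x in near_origin n. f x = f (tr (Suc m) x) + (\<Sum>i<Suc m. x i * (g(m := gm)) i x)"
      using g(2) gm(2) by eventually_elim simp
    then show ?case
      using g(1) gm(1) by (intro exI[of _ "g(m := gm)"]) (auto simp: less_Suc_eq)
  qed
  then obtain g where g: "\<forall>i<n. C_fun n (g i)"
    "\<forall>\<^sub>F x in near_origin n. f x = f (tr n x) + (\<Sum>i<n. x i * g i x)"
    by blast
  have "\<forall>\<^sub>F x in near_origin n. f x = f origin + (\<Sum>i<n. x i * g i x)"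
    using g(2) near_origin_space
  proof eventually_elim
    case (elim x)
    then have "tr n x = origin" by (auto simp: tr_def fun_eq_iff)
    with elim show ?case by simp
  qed
  with g(1) show ?thesis by (intro exI[of _ g] conjI)
qed

lemma word_expansion:
  assumes "C_fun n f"
  shows "\<exists>R. (\<forall>w. set w \<subseteq> {..<n} \<longrightarrow> C_fun n (R w)) \<and>
    (\<forall>k. \<forall>\<^sub>F x in near_origin n. f x = (\<Sum>j<k. word_form n (\<lambda>w. R w origin) j x)
        + (\<Sum>w\<in>words n k. R w x * prod_list (map x w)))"
proof -
  have "\<forall>f. \<exists>g. C_fun n f \<longrightarrow> (\<forall>i<n. C_fun n (g i)) \<and>
    (\<forall>\<^sub>F x in near_origin n. f x = f origin + (\<Sum>i<n. x i * g i x))"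
    using Hadamard_expansion[of n] by simp
  from choice[OF this] obtain G where "\<forall>f. C_fun n f \<longrightarrow> (\<forall>i<n. C_fun n (G f i)) \<and>
    (\<forall>\<^sub>F x in near_origin n. f x = f origin + (\<Sum>i<n. x i * G f i x))" ..
  then have G: "C_fun n f \<Longrightarrow> i < n \<Longrightarrow> C_fun n (G f i)"
    "C_fun n f \<Longrightarrow> \<forall>\<^sub>F x in near_origin n. f x = f origin + (\<Sum>i<n. x i * G f i x)" for f i
    by simp_all
  define R where "R = foldr (\<lambda>i f. G f i)"
  have R: "C_fun n (R w f)" if "set w \<subseteq> {..<n}" for w
    using that by (induction w) (auto simp: R_def assms intro: G(1))
  have "\<forall>\<^sub>F x in near_origin n. f x = (\<Sum>j<k. word_form n (\<lambda>w. R w f origin) j x)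
        + (\<Sum>w\<in>words n k. R w f x * prod_list (map x w))" for k
  proof (induction k)
    case 0
    show ?case by (simp add: words_0 R_def)
  next
    case (Suc k)
    have "\<forall>\<^sub>F x in near_origin n. \<forall>w\<in>words n k.
        R w f x = R w f origin + (\<Sum>i<n. x i * R (i # w) f x)"
    proof (intro eventually_ball_finite finite_words ballI)
      fix w assume "w \<in> words n k"
      then have "set w \<subseteq> {..<n}" by (simp add: words_def)
      from G(2)[OF R[OF this]]
      show "\<forall>\<^sub>F x in near_origin n. R w f x = R w f origin + (\<Sum>i<n. x i * R (i # w) f x)"
        by (simp add: R_def)
    qed
    with Suc show ?case
    proof eventually_elim
      case (elim x)
      have "(\<Sum>w\<in>words n k. R w f x * prod_list (map x w))
          = (\<Sum>w\<in>words n k. R w f origin * prod_list (map x w)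
            + (\<Sum>i<n. R (i # w) f x * prod_list (map x (i # w))))"
      proof (rule sum.cong[OF refl])
        fix w assume "w \<in> words n k"
        then have "R w f x = R w f origin + (\<Sum>i<n. x i * R (i # w) f x)"
          using elim(2) by blast
        then have "R w f x * prod_list (map x w)
            = (R w f origin + (\<Sum>i<n. x i * R (i # w) f x)) * prod_list (map x w)"
          by (rule arg_cong)
        also have "\<dots> = R w f origin * prod_list (map x w)
            + (\<Sum>i<n. R (i # w) f x * prod_list (map x (i # w)))"
          by (simp add: algebra_simps sum_distrib_left)
        finally show "R w f x * prod_list (map x w) = R w f origin * prod_list (map x w)
            + (\<Sum>i<n. R (i # w) f x * prod_list (map x (i # w)))" .
      qed
      also have "\<dots> = word_form n (\<lambda>w. R w f origin) k x
          + (\<Sum>w\<in>words n (Suc k). R w f x * prod_list (map x w))"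
        by (simp add: sum.distrib word_form_def sum_words_Suc)
      finally show ?case using elim(1) by simp
    qed
  qed
  with R show ?thesis by (intro exI[of _ "\<lambda>w. R w f"] conjI allI impI)
qed

lemma ray_expansion:
  assumes "C_fun n f"
  shows "\<exists>c. \<forall>\<theta> k. (\<forall>i\<ge>n. \<theta> i = 0) \<longrightarrow>
    ((\<lambda>u. (f (\<lambda>i. u * \<theta> i) - (\<Sum>j<k. word_form n c j \<theta> * u ^ j)) / u ^ k) \<longlongrightarrow> word_form n c k \<theta>) (at 0)"
proof -
  obtain R where "\<forall>w. set w \<subseteq> {..<n} \<longrightarrow> C_fun n (R w)"
    "\<forall>k. \<forall>\<^sub>F x in near_origin n. f x = (\<Sum>j<k. word_form n (\<lambda>w. R w origin) j x)
        + (\<Sum>w\<in>words n k. R w x * prod_list (map x w))"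
    using word_expansion[OF assms] by blast
  then have R: "\<And>w. set w \<subseteq> {..<n} \<Longrightarrow> C_fun n (R w)"
    "\<And>k. \<forall>\<^sub>F x in near_origin n. f x = (\<Sum>j<k. word_form n (\<lambda>w. R w origin) j x)
        + (\<Sum>w\<in>words n k. R w x * prod_list (map x w))"
    by simp_all
  define c where "c = (\<lambda>w. R w origin)"
  show ?thesis
  proof (intro exI[of _ c] allI impI)
    fix \<theta> :: point and k assume th: "\<forall>i\<ge>n. \<theta> i = 0"
    have lim: "filterlim (\<lambda>u. (\<lambda>i. u * \<theta> i)) (near_origin n) (at (0::real))"
      by (rule filterlim_near_origin) (use th in \<open>auto intro!: tendsto_eq_intros\<close>)
    have "((\<lambda>u. \<Sum>w\<in>words n k. R w (\<lambda>i. u * \<theta> i) * prod_list (map \<theta> w)) \<longlongrightarrow> word_form n c k \<theta>) (at 0)"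
      unfolding word_form_def c_def
    proof (intro tendsto_sum tendsto_mult tendsto_const)
      fix w assume "w \<in> words n k"
      then have "C_fun n (R w)" by (intro R) (auto simp: words_def)
      from filterlim_compose[OF C_fun_tendsto[OF this] lim]
      show "((\<lambda>u. R w (\<lambda>i. u * \<theta> i)) \<longlongrightarrow> R w origin) (at 0)" .
    qed
    moreover have "\<forall>\<^sub>F u in at 0. (\<Sum>w\<in>words n k. R w (\<lambda>i. u * \<theta> i) * prod_list (map \<theta> w))
        = (f (\<lambda>i. u * \<theta> i) - (\<Sum>j<k. word_form n c j \<theta> * u ^ j)) / u ^ k"
    proof -
      have "\<forall>\<^sub>F u::real in at 0. u \<noteq> 0" by (simp add: eventually_at_filter)
      moreover have "\<forall>\<^sub>F u in at 0. f (\<lambda>i. u * \<theta> i) = (\<Sum>j<k. word_form n c j (\<lambda>i. u * \<theta> i))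
          + (\<Sum>w\<in>words n k. R w (\<lambda>i. u * \<theta> i) * prod_list (map (\<lambda>i. u * \<theta> i) w))"
        using lim R(2)[of k, folded c_def] unfolding filterlim_iff by blast
      ultimately show ?thesis
      proof eventually_elim
        case (elim u)
        have "(\<Sum>w\<in>words n k. R w (\<lambda>i. u * \<theta> i) * prod_list (map (\<lambda>i. u * \<theta> i) w))
            = (\<Sum>w\<in>words n k. R w (\<lambda>i. u * \<theta> i) * prod_list (map \<theta> w)) * u ^ k"
          unfolding prod_list_scale sum_distrib_right by (intro sum.cong) (auto simp: words_def)
        with elim show ?case by (simp add: word_form_scale)
      qed
    qed
    ultimately show "((\<lambda>u. (f (\<lambda>i. u * \<theta> i) - (\<Sum>j<k. word_form n c j \<theta> * u ^ j)) / u ^ k)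
        \<longlongrightarrow> word_form n c k \<theta>) (at 0)"
      by (rule Lim_transform_eventually)
  qed
qed

end

text \<open>
  The coefficients \<open>b\<close> need only describe \<open>g\<close> asymptotically at each finite order, on a neighbourhood
  that may shrink with the order. This matches the expansions of \<open>ray_expansion\<close>.
\<close>

lemma power_series_unique_asymptotic:
  fixes a b :: "nat \<Rightarrow> real"
  assumes "\<delta> > 0" and sums: "\<And>u. \<bar>u\<bar> < \<delta> \<Longrightarrow> (\<lambda>j. a j * u ^ j) sums g u"
    and asym: "\<And>k. ((\<lambda>u. (g u - (\<Sum>j<k. b j * u ^ j)) / u ^ k) \<longlongrightarrow> b k) (at 0)"
  shows "a k = b k"
proof (induction k rule: less_induct)
  case (less k)
  have "((\<lambda>u. (g u - (\<Sum>j<k. a j * u ^ j)) / u ^ k) \<longlongrightarrow> a k) (at 0)"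
  proof (rule powser_limit_0_strong[OF \<open>\<delta> > 0\<close>, of "\<lambda>j. a (j + k)", simplified])
    fix u :: real assume u: "u \<noteq> 0" "\<bar>u\<bar> < \<delta>"
    have "(\<lambda>j. a (j + k) * u ^ (j + k)) sums (g u - (\<Sum>j<k. a j * u ^ j))"
      using sums_split_initial_segment[OF sums[OF u(2)]] .
    from sums_divide[OF this, of "u ^ k"]
    show "(\<lambda>j. a (j + k) * u ^ j) sums ((g u - (\<Sum>j<k. a j * u ^ j)) / u ^ k)"
      using u(1) by (simp add: power_add)
  qed
  moreover have "(\<Sum>j<k. a j * u ^ j) = (\<Sum>j<k. b j * u ^ j)" for u
    by (intro sum.cong) (auto simp: less)
  ultimately show ?case
    using asym[of k] LIM_unique by simp
qed

section \<open>Coefficients of bounded homogeneous polynomials\<close>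

definition multi_indices_deg :: "nat \<Rightarrow> nat \<Rightarrow> (nat \<Rightarrow> nat) set" where
  "multi_indices_deg n k = {\<alpha> \<in> multi_indices n. (\<Sum>i<n. \<alpha> i) = k}"

lemma finite_multi_indices_deg: "finite (multi_indices_deg n k)"
proof (rule finite_subset)
  show "multi_indices_deg n k \<subseteq> (\<lambda>g i. if i < n then g i else 0) ` ({..<n} \<rightarrow>\<^sub>E {..k})"
  proof
    fix \<alpha> assume a: "\<alpha> \<in> multi_indices_deg n k"
    have "\<alpha> i \<le> k" if "i < n" for i
      using a member_le_sum[of i "{..<n}" \<alpha>] that by (auto simp: multi_indices_deg_def)
    then show "\<alpha> \<in> (\<lambda>g i. if i < n then g i else 0) ` ({..<n} \<rightarrow>\<^sub>E {..k})"
      using a by (intro image_eqI[of _ _ "restrict \<alpha> {..<n}"])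
        (auto simp: multi_indices_deg_def multi_indices_def fun_eq_iff)
  qed
qed (auto intro!: finite_imageI finite_PiE)

lemma prod_list_multi_index:
  fixes x :: "nat \<Rightarrow> real"
  shows "set w \<subseteq> {..<n} \<Longrightarrow> prod_list (map x w) = (\<Prod>i<n. x i ^ count_list w i)"
proof (induction w)
  case (Cons a w)
  have "(\<Prod>i<n. x i ^ count_list (a # w) i) = (\<Prod>i<n. (if i = a then x i else 1) * x i ^ count_list w i)"
    by (intro prod.cong) auto
  also have "\<dots> = x a * (\<Prod>i<n. x i ^ count_list w i)"
    using Cons.prems by (simp add: prod.distrib prod.delta)
  finally show ?case using Cons by simp
qed simp

lemma word_form_multi_index:
  "\<exists>d. \<forall>k x. word_form n c k x = (\<Sum>\<alpha>\<in>multi_indices_deg n k. d \<alpha> * (\<Prod>i<n. x i ^ \<alpha> i))"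
proof (intro exI allI)
  let ?d = "\<lambda>\<alpha>. \<Sum>w\<in>{w \<in> words n (\<Sum>i<n. \<alpha> i). count_list w = \<alpha>}. c w"
  fix k x
  have cl: "count_list w \<in> multi_indices_deg n k" if "w \<in> words n k" for w
  proof -
    have "(\<Sum>i<n. count_list w i) = length w"
      using that by (intro sum_count_set) (auto simp: words_def)
    then show ?thesis using that
      by (auto simp: multi_indices_deg_def multi_indices_def words_def count_list_0_iff)
  qed
  have "word_form n c k x = (\<Sum>\<alpha>\<in>multi_indices_deg n k. \<Sum>w\<in>{w \<in> words n k. count_list w = \<alpha>}. c w * prod_list (map x w))"
    unfolding word_form_def
    by (rule sum.group[symmetric]) (use finite_words finite_multi_indices_deg cl in auto)
  also have "\<dots> = (\<Sum>\<alpha>\<in>multi_indices_deg n k. ?d \<alpha> * (\<Prod>i<n. x i ^ \<alpha> i))"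
    by (intro sum.cong refl, subst sum_distrib_right, intro sum.cong)
      (auto simp: multi_indices_deg_def words_def prod_list_multi_index)
  finally show "word_form n c k x = (\<Sum>\<alpha>\<in>multi_indices_deg n k. ?d \<alpha> * (\<Prod>i<n. x i ^ \<alpha> i))" .
qed

text \<open>
  The \<open>a\<close>-th finite difference annihilates polynomials of degree less than \<open>a\<close> and maps the
  monomial of degree \<open>a\<close> to \<open>fact a\<close>.
\<close>

lemma alternating_binomial_power_sum:
  fixes x :: real
  assumes "b \<le> a"
  shows "(\<Sum>j\<le>a. (-1) ^ (a - j) * real (a choose j) * (x + real j) ^ b) = (if b = a then fact a else 0)"
  using assms
proof (induction b arbitrary: a x)
  case 0
  show ?case
    using binomial_ring[of "1::real" "-1" a] by (cases a) (simp_all add: mult.commute)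
next
  case (Suc b)
  then obtain a' where a: "a = Suc a'" "b \<le> a'" by (cases a) auto
  let ?T = "\<lambda>a b x. \<Sum>j\<le>a. (-1) ^ (a - j) * real (a choose j) * (x + real j) ^ b"
  have "?T a (Suc b) x = x * ?T a b x
      + (\<Sum>j\<le>a. (-1) ^ (a - j) * real (a choose j) * (real j * (x + real j) ^ b))"
    by (simp add: algebra_simps sum.distrib sum_distrib_left)
  also have "?T a b x = 0" using Suc.IH[of a x] a by simp
  also have "(\<Sum>j\<le>a. (-1) ^ (a - j) * real (a choose j) * (real j * (x + real j) ^ b))
      = (\<Sum>j\<le>a'. (-1) ^ (a' - j) * (real (Suc j) * real (Suc a' choose Suc j)) * ((x + 1) + real j) ^ b)"
    unfolding a(1) by (subst sum.atMost_Suc_shift) (simp add: algebra_simps)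
  also have "\<dots> = real (Suc a') * ?T a' b (x + 1)"
    unfolding sum_distrib_left
  proof (intro sum.cong refl)
    fix j
    have "real (Suc j) * real (Suc a' choose Suc j) = real (Suc a') * real (a' choose j)"
      using Suc_times_binomial[of j a'] by (metis of_nat_mult)
    then show "(-1) ^ (a' - j) * (real (Suc j) * real (Suc a' choose Suc j)) * ((x + 1) + real j) ^ b
        = real (Suc a') * ((-1) ^ (a' - j) * real (a' choose j) * ((x + 1) + real j) ^ b)"
      by simp
  qed
  also have "?T a' b (x + 1) = (if b = a' then fact a' else 0)" by (rule Suc.IH[OF a(2)])
  finally show ?case using a by simp
qed

text \<open>
  Taking the \<open>\<alpha> i\<close>-th finite difference with step \<open>h i\<close> in each coordinate isolates the coefficient at
  \<open>\<alpha>\<close>: any other multi-index of the same degree is smaller than \<open>\<alpha>\<close> in some coordinate, and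
  the difference in that coordinate annihilates its monomial.
\<close>

lemma coefficient_by_finite_differences:
  fixes d :: "(nat \<Rightarrow> nat) \<Rightarrow> real" and h :: "nat \<Rightarrow> real"
  assumes "\<alpha> \<in> multi_indices_deg n k"
    and P: "\<And>x. P x = (\<Sum>\<beta>\<in>multi_indices_deg n k. d \<beta> * (\<Prod>i<n. x i ^ \<beta> i))"
  shows "(\<Sum>J\<in>(\<Pi>\<^sub>E i\<in>{..<n}. {..\<alpha> i}). (\<Prod>i<n. (-1) ^ (\<alpha> i - J i) * real (\<alpha> i choose J i))
      * P (\<lambda>i. if i < n then h i * real (J i) else 0)) = d \<alpha> * (\<Prod>i<n. h i ^ \<alpha> i * fact (\<alpha> i))"
    (is "?L = _")
proof -
  let ?X = "\<Pi>\<^sub>E i\<in>{..<n}. {..\<alpha> i}"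
  let ?s = "\<lambda>i j. (-1) ^ (\<alpha> i - j) * real (\<alpha> i choose j)"
  have "?L = (\<Sum>J\<in>?X. \<Sum>\<beta>\<in>multi_indices_deg n k. d \<beta> * (\<Prod>i<n. ?s i (J i) * (h i * real (J i)) ^ \<beta> i))"
    unfolding P sum_distrib_left
    by (intro sum.cong refl) (simp add: prod.distrib algebra_simps)
  also have "\<dots> = (\<Sum>\<beta>\<in>multi_indices_deg n k. d \<beta> * (\<Sum>J\<in>?X. \<Prod>i<n. ?s i (J i) * (h i * real (J i)) ^ \<beta> i))"
    unfolding sum_distrib_left by (rule sum.swap)
  also have "\<dots> = (\<Sum>\<beta>\<in>multi_indices_deg n k. d \<beta> * (\<Prod>i<n. \<Sum>j\<le>\<alpha> i. ?s i j * (h i * real j) ^ \<beta> i))"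
    by (subst prod_sum_PiE) auto
  also have "\<dots> = (\<Sum>\<beta>\<in>multi_indices_deg n k. if \<beta> = \<alpha> then d \<alpha> * (\<Prod>i<n. h i ^ \<alpha> i * fact (\<alpha> i)) else 0)"
  proof (intro sum.cong refl)
    fix \<beta> assume b: "\<beta> \<in> multi_indices_deg n k"
    have T: "(\<Sum>j\<le>\<alpha> i. ?s i j * (h i * real j) ^ \<beta> i) = h i ^ \<beta> i * (if \<beta> i = \<alpha> i then fact (\<alpha> i) else 0)"
      if "\<beta> i \<le> \<alpha> i" for i
      using alternating_binomial_power_sum[OF that, of 0]
      by (simp add: power_mult_distrib sum_distrib_left[symmetric] mult.left_commute[of _ "h i ^ \<beta> i"])
    show "d \<beta> * (\<Prod>i<n. \<Sum>j\<le>\<alpha> i. ?s i j * (h i * real j) ^ \<beta> i)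
        = (if \<beta> = \<alpha> then d \<alpha> * (\<Prod>i<n. h i ^ \<alpha> i * fact (\<alpha> i)) else 0)"
    proof (cases "\<beta> = \<alpha>")
      case False
      have "\<exists>i<n. \<beta> i < \<alpha> i"
      proof (rule ccontr)
        assume "\<not> (\<exists>i<n. \<beta> i < \<alpha> i)"
        then have le: "\<alpha> i \<le> \<beta> i" if "i < n" for i using that by (meson not_le)
        obtain i where i: "\<beta> i \<noteq> \<alpha> i" using False by auto
        then have "i < n"
          using b assms(1) by (auto simp: multi_indices_deg_def multi_indices_def not_le[symmetric])
        then have "(\<Sum>i<n. \<alpha> i) < (\<Sum>i<n. \<beta> i)"
          using le i by (intro sum_strict_mono_ex1) (auto intro!: bexI[of _ i] le_neq_implies_less)
        then show False using b assms(1) by (simp add: multi_indices_deg_def)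
      qed
      then obtain i where "i < n" "\<beta> i < \<alpha> i" by blast
      then have "(\<Prod>i<n. \<Sum>j\<le>\<alpha> i. ?s i j * (h i * real j) ^ \<beta> i) = 0"
        by (intro prod_zero bexI[of _ i]) (simp_all add: T)
      then show ?thesis using False by simp
    next
      case True
      have "(\<Prod>i<n. \<Sum>j\<le>\<alpha> i. ?s i j * (h i * real j) ^ \<beta> i) = (\<Prod>i<n. h i ^ \<alpha> i * fact (\<alpha> i))"
        by (intro prod.cong refl, subst T) (simp_all add: True)
      then show ?thesis using True by simp
    qed
  qed
  also have "\<dots> = d \<alpha> * (\<Prod>i<n. h i ^ \<alpha> i * fact (\<alpha> i))"
    using assms(1) finite_multi_indices_deg by (simp add: sum.delta)
  finally show ?thesis .
qed

lemma Suc_power_le_fact: "real (Suc a) ^ a \<le> 4 ^ a * fact a"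
proof (induction a)
  case (Suc a)
  have "real (Suc (Suc a)) = real (Suc a) * (1 + 1 / real (Suc a))"
    by (simp add: field_simps)
  then have "real (Suc (Suc a)) ^ Suc a = (real (Suc a) * (1 + 1 / real (Suc a))) ^ Suc a"
    by (rule arg_cong)
  also have "\<dots> = real (Suc a) * real (Suc a) ^ a * (1 + 1 / real (Suc a)) ^ Suc a"
    unfolding power_mult_distrib by simp
  also have "\<dots> \<le> real (Suc a) * (4 ^ a * fact a) * 4"
  proof (intro mult_mono Suc order_refl)
    have "(1 + 1 / real (Suc a)) ^ Suc a \<le> exp 1"
      by (rule exp_ge_one_plus_x_over_n_power_n) auto
    then show "(1 + 1 / real (Suc a)) ^ Suc a \<le> 4" using exp_le by linarith
  qed auto
  finally show ?case by (simp add: algebra_simps)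
qed simp

text \<open>
  The differences have step \<open>h i = \<delta> / (\<alpha> i + 1)\<close> in coordinate \<open>i\<close>, adapted to \<open>\<alpha> i\<close> and such that all
  sample points lie in the cube. The loss \<open>(\<alpha> i + 1) ^ \<alpha> i / fact (\<alpha> i)\<close> is only exponential, and so is
  the sum of the binomial coefficients.
\<close>

lemma coefficient_bound:
  assumes a: "\<alpha> \<in> multi_indices_deg n k" and "\<delta> > 0"
    and P: "\<And>x. P x = (\<Sum>\<beta>\<in>multi_indices_deg n k. d \<beta> * (\<Prod>i<n. x i ^ \<beta> i))"
    and bound: "\<And>x. x \<in> cube n \<delta> \<Longrightarrow> \<bar>P x\<bar> \<le> M"
  shows "\<bar>d \<alpha>\<bar> \<le> M * (8 / \<delta>) ^ k"
proof -
  have k: "(\<Sum>i<n. \<alpha> i) = k" using a by (simp add: multi_indices_deg_def)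
  have "M \<ge> 0" using bound[OF origin_in_cube[OF \<open>\<delta> > 0\<close>]] by simp
  define h where "h = (\<lambda>i. \<delta> / real (Suc (\<alpha> i)))"
  have h: "h i > 0" for i using \<open>\<delta> > 0\<close> by (simp add: h_def)
  let ?X = "\<Pi>\<^sub>E i\<in>{..<n}. {..\<alpha> i}"
  have "(\<delta> / 4) ^ k = (\<Prod>i<n. (\<delta> / 4) ^ \<alpha> i)"
    by (simp add: k[symmetric] power_sum)
  also have "\<dots> \<le> (\<Prod>i<n. h i ^ \<alpha> i * fact (\<alpha> i))"
  proof (intro prod_mono conjI)
    fix i
    have "(\<delta> / 4) ^ \<alpha> i * real (Suc (\<alpha> i)) ^ \<alpha> i \<le> (\<delta> / 4) ^ \<alpha> i * (4 ^ \<alpha> i * fact (\<alpha> i))"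
      using \<open>\<delta> > 0\<close> by (intro mult_left_mono Suc_power_le_fact) auto
    also have "\<dots> = \<delta> ^ \<alpha> i * fact (\<alpha> i)"
      by (simp add: power_divide)
    finally show "(\<delta> / 4) ^ \<alpha> i \<le> h i ^ \<alpha> i * fact (\<alpha> i)"
      by (simp add: h_def power_divide[of \<delta> "real (Suc (\<alpha> i))"] pos_le_divide_eq del: of_nat_Suc)
  qed (use \<open>\<delta> > 0\<close> in auto)
  finally have "\<bar>d \<alpha>\<bar> * (\<delta> / 4) ^ k \<le> \<bar>d \<alpha>\<bar> * (\<Prod>i<n. h i ^ \<alpha> i * fact (\<alpha> i))"
    by (rule mult_left_mono) auto
  also have "\<dots> = \<bar>d \<alpha> * (\<Prod>i<n. h i ^ \<alpha> i * fact (\<alpha> i))\<bar>"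
    using h by (simp add: abs_mult abs_of_nonneg prod_nonneg less_imp_le)
  also have "\<dots> = \<bar>\<Sum>J\<in>?X. (\<Prod>i<n. (-1) ^ (\<alpha> i - J i) * real (\<alpha> i choose J i))
      * P (\<lambda>i. if i < n then h i * real (J i) else 0)\<bar>"
    by (subst coefficient_by_finite_differences[OF a P]) simp
  also have "\<dots> \<le> (\<Sum>J\<in>?X. (\<Prod>i<n. real (\<alpha> i choose J i)) * M)"
  proof (rule order_trans[OF sum_abs], rule sum_mono)
    fix J assume J: "J \<in> ?X"
    have "(\<lambda>i. if i < n then h i * real (J i) else 0) \<in> cube n \<delta>"
    proof -
      have "h i * real (J i) < \<delta>" if "i < n" for i
      proof -
        have "J i \<le> \<alpha> i" using J that by auto
        then have "h i * real (J i) < h i * real (Suc (\<alpha> i))"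
          using h by (intro mult_strict_left_mono) auto
        then show ?thesis by (simp add: h_def)
      qed
      then show ?thesis using h by (simp add: cube_def abs_mult less_imp_le)
    qed
    from mult_left_mono[OF bound[OF this], of "\<Prod>i<n. real (\<alpha> i choose J i)"]
    show "\<bar>(\<Prod>i<n. (-1) ^ (\<alpha> i - J i) * real (\<alpha> i choose J i))
        * P (\<lambda>i. if i < n then h i * real (J i) else 0)\<bar> \<le> (\<Prod>i<n. real (\<alpha> i choose J i)) * M"
      by (simp add: abs_mult abs_prod power_abs prod_nonneg)
  qed
  also have "\<dots> = (\<Prod>i<n. \<Sum>j\<le>\<alpha> i. real (\<alpha> i choose j)) * M"
    by (subst prod_sum_PiE) (auto simp: sum_distrib_right)
  also have "(\<Prod>i<n. \<Sum>j\<le>\<alpha> i. real (\<alpha> i choose j)) = (\<Prod>i<n. 2 ^ \<alpha> i)"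
    by (intro prod.cong refl) (metis choose_row_sum of_nat_numeral of_nat_power of_nat_sum)
  also have "\<dots> = 2 ^ k" by (simp add: k[symmetric] power_sum)
  finally have "\<bar>d \<alpha>\<bar> * (\<delta> / 4) ^ k \<le> 2 ^ k * M" .
  then have "\<bar>d \<alpha>\<bar> \<le> 2 ^ k * M / (\<delta> / 4) ^ k"
    using \<open>\<delta> > 0\<close> by (simp add: pos_le_divide_eq)
  also have "\<dots> = M * (2 / (\<delta> / 4)) ^ k" by (simp only: power_divide) simp
  finally show ?thesis by simp
qed

lemma summable_geometric_multi_indices:
  "(\<lambda>\<alpha>. \<Prod>i<n. (1/2::real) ^ \<alpha> i) summable_on multi_indices n"
proof (rule nonneg_bdd_above_summable_on)
  show "bdd_above (sum (\<lambda>\<alpha>. \<Prod>i<n. (1/2::real) ^ \<alpha> i) ` {F. F \<subseteq> multi_indices n \<and> finite F})"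
  proof (rule bdd_aboveI2)
    fix F assume "F \<in> {F. F \<subseteq> multi_indices n \<and> finite F}"
    then have F: "F \<subseteq> multi_indices n" "finite F" by auto
    define m where "m = Max (insert 0 (\<Union>\<alpha>\<in>F. \<alpha> ` {..<n}))"
    have m: "\<alpha> i \<le> m" if "\<alpha> \<in> F" "i < n" for \<alpha> i
      unfolding m_def using that F(2) by (intro Max_ge) auto
    have inj: "inj_on (\<lambda>\<alpha>. restrict \<alpha> {..<n}) F"
    proof (rule inj_onI, rule ext)
      fix \<alpha> \<beta> i assume "\<alpha> \<in> F" "\<beta> \<in> F" and eq: "restrict \<alpha> {..<n} = restrict \<beta> {..<n}"
      show "\<alpha> i = \<beta> i"
      proof (cases "i < n")
        case True
        then show ?thesis using fun_cong[OF eq, of i] by simp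
      next
        case False
        moreover have "\<alpha> \<in> multi_indices n" "\<beta> \<in> multi_indices n"
          using F(1) \<open>\<alpha> \<in> F\<close> \<open>\<beta> \<in> F\<close> by auto
        ultimately show ?thesis by (simp add: multi_indices_def)
      qed
    qed
    have "(\<Sum>\<alpha>\<in>F. \<Prod>i<n. (1/2::real) ^ \<alpha> i) = (\<Sum>\<alpha>\<in>F. \<Prod>i<n. (1/2::real) ^ restrict \<alpha> {..<n} i)"
      by (intro sum.cong prod.cong) auto
    also have "\<dots> = (\<Sum>\<alpha>\<in>(\<lambda>\<alpha>. restrict \<alpha> {..<n}) ` F. \<Prod>i<n. (1/2::real) ^ \<alpha> i)"
      by (simp add: sum.reindex[OF inj] o_def)
    also have "\<dots> \<le> (\<Sum>\<alpha>\<in>{..<n} \<rightarrow>\<^sub>E {..m}. \<Prod>i<n. (1/2::real) ^ \<alpha> i)"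
    proof (rule sum_mono2)
      show "(\<lambda>\<alpha>. restrict \<alpha> {..<n}) ` F \<subseteq> {..<n} \<rightarrow>\<^sub>E {..m}"
        by (rule image_subsetI) (simp add: restrict_PiE_iff m)
    qed (auto simp: finite_PiE intro!: prod_nonneg)
    also have "\<dots> = (\<Prod>i<n. \<Sum>j\<le>m. (1/2::real) ^ j)"
      by (subst prod_sum_PiE) auto
    also have "\<dots> \<le> (\<Prod>i<n. 2)"
    proof (intro prod_mono conjI sum_nonneg)
      show "(\<Sum>j\<le>m. (1/2::real) ^ j) \<le> 2"
        using sum_gp0[of "1/2::real" m] by simp
    qed auto
    finally show "(\<Sum>\<alpha>\<in>F. \<Prod>i<n. (1/2::real) ^ \<alpha> i) \<le> 2 ^ n" by simp
  qed
qed (auto intro!: prod_nonneg)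

lemma has_sum_multi_indices:
  fixes g :: "(nat \<Rightarrow> nat) \<Rightarrow> real"
  assumes "g summable_on multi_indices n"
    and "(\<lambda>k. \<Sum>\<alpha>\<in>multi_indices_deg n k. g \<alpha>) sums S"
  shows "(g has_sum S) (multi_indices n)"
proof -
  let ?A = "Sigma UNIV (multi_indices_deg n)"
  have bij: "multi_indices n = snd ` ?A" "inj_on snd ?A"
    by (force simp: multi_indices_deg_def image_iff, auto simp: inj_on_def multi_indices_deg_def)
  have "(g has_sum infsum g (multi_indices n)) (multi_indices n)"
    using assms(1) by simp
  then have "((\<lambda>(k, \<alpha>). g \<alpha>) has_sum infsum g (multi_indices n)) ?A"
    unfolding bij(1) has_sum_reindex[OF bij(2)] by (simp add: o_def case_prod_beta')
  then have "((\<lambda>k. \<Sum>\<alpha>\<in>multi_indices_deg n k. g \<alpha>) has_sum infsum g (multi_indices n)) UNIV"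
    by (rule has_sum_SigmaD) (auto intro: has_sum_finite finite_multi_indices_deg)
  then have "(\<lambda>k. \<Sum>\<alpha>\<in>multi_indices_deg n k. g \<alpha>) sums infsum g (multi_indices n)"
    by (rule has_sum_imp_sums)
  then have "infsum g (multi_indices n) = S" using assms(2) sums_unique2 by blast
  then show ?thesis using assms(1) by auto
qed

section \<open>Convergence of the Taylor series\<close>

lemma holomorphic_real_power_series:
  fixes F :: "complex \<Rightarrow> complex" and g :: "real \<Rightarrow> real"
  assumes "\<delta> > 0" and hol: "F holomorphic_on ball 0 \<delta>"
    and bound: "\<And>w. w \<in> ball 0 \<delta> \<Longrightarrow> cmod (F w) \<le> M"
    and real: "\<And>u. \<bar>u\<bar> < \<delta> \<Longrightarrow> F (complex_of_real u) = complex_of_real (g u)"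
  shows "\<exists>a. (\<forall>u. \<bar>u\<bar> < \<delta> \<longrightarrow> (\<lambda>j. a j * u ^ j) sums g u) \<and> (\<forall>j. \<bar>a j\<bar> \<le> M * (2 / \<delta>) ^ j)"
proof (intro exI conjI allI impI)
  let ?A = "\<lambda>j. (deriv ^^ j) F 0 / fact j"
  show "(\<lambda>j. Re (?A j) * u ^ j) sums g u" if "\<bar>u\<bar> < \<delta>" for u
  proof -
    have "(\<lambda>j. ?A j * (complex_of_real u - 0) ^ j) sums F (complex_of_real u)"
      by (rule holomorphic_power_series[OF hol]) (use that in simp)
    from sums_Re[OF this]
    have "(\<lambda>j. Re (?A j * complex_of_real (u ^ j))) sums Re (complex_of_real (g u))"
      by (simp only: real[OF that] diff_0_right of_real_power)
    moreover have "Re (w * complex_of_real r) = Re w * r" for w r by simp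
    ultimately show ?thesis by (simp only: Re_complex_of_real)
  qed
  show "\<bar>Re (?A j)\<bar> \<le> M * (2 / \<delta>) ^ j" for j
  proof -
    have "cmod ((deriv ^^ j) F 0) \<le> fact j * M / (\<delta> / 2) ^ j"
    proof (rule Cauchy_inequality)
      show "F holomorphic_on ball 0 (\<delta> / 2)"
        by (rule holomorphic_on_subset[OF hol]) (use \<open>\<delta> > 0\<close> in auto)
      show "continuous_on (cball 0 (\<delta> / 2)) F"
        by (rule continuous_on_subset[OF holomorphic_on_imp_continuous_on[OF hol]])
          (use \<open>\<delta> > 0\<close> in auto)
      show "cmod (F x) \<le> M" if "cmod (0 - x) = \<delta> / 2" for x
        by (rule bound) (use that \<open>\<delta> > 0\<close> in simp)
    qed (use \<open>\<delta> > 0\<close> in simp)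
    then have "cmod (?A j) \<le> M / (\<delta> / 2) ^ j"
      by (simp add: norm_divide divide_le_eq mult.commute)
    moreover have "M / (\<delta> / 2) ^ j = M * (2 / \<delta>) ^ j"
      by (simp add: power_divide)
    ultimately show ?thesis using abs_Re_le_cmod[of "?A j"] by linarith
  qed
qed

context quasianalytic_system
begin

text \<open>
  A small point \<open>x\<close> is reached on the ray through \<open>\<theta> = x / (\<delta> / 2)\<close> at the time \<open>\<delta> / 2\<close>, inside the disc of
  convergence; there \<open>f x\<close> is the sum of its homogeneous parts. Absolute convergence
  over all multi-indices permits replacing the homogeneous parts by their monomials.
\<close>

lemma C_fun_analytic:
  assumes "weierstrass_preparation C" "C_fun n f"
  shows "germ n f \<in> analytic_germs n"
proof -
  define h where "h = (\<lambda>x. f (\<lambda>i. if i < n then x n * x i else 0))"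
  have "C_fun (Suc n) h"
    unfolding h_def by (rule C_fun_subst[OF assms(2)]) (auto intro!: C_fun_intros)
  then obtain \<delta> M and F :: "point \<Rightarrow> complex \<Rightarrow> complex" where \<delta>: "\<delta> > 0"
    and "\<forall>\<theta>\<in>cube n \<delta>. F \<theta> holomorphic_on ball 0 \<delta> \<and> (\<forall>w\<in>ball 0 \<delta>. cmod (F \<theta> w) \<le> M) \<and>
      (\<forall>u. \<bar>u\<bar> < \<delta> \<longrightarrow> F \<theta> (complex_of_real u) = complex_of_real (h (\<theta>(n := u))))"
    using complex_extension[OF assms(1)] by blast
  then have F: "\<And>\<theta>. \<theta> \<in> cube n \<delta> \<Longrightarrow> F \<theta> holomorphic_on ball 0 \<delta>"
      "\<And>\<theta> w. \<theta> \<in> cube n \<delta> \<Longrightarrow> w \<in> ball 0 \<delta> \<Longrightarrow> cmod (F \<theta> w) \<le> M"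
      "\<And>\<theta> u. \<theta> \<in> cube n \<delta> \<Longrightarrow> \<bar>u\<bar> < \<delta> \<Longrightarrow> F \<theta> (complex_of_real u) = complex_of_real (h (\<theta>(n := u)))"
    by simp_all
  obtain c where "\<forall>\<theta> k. (\<forall>i\<ge>n. \<theta> i = 0) \<longrightarrow>
    ((\<lambda>u. (f (\<lambda>i. u * \<theta> i) - (\<Sum>j<k. word_form n c j \<theta> * u ^ j)) / u ^ k) \<longlongrightarrow> word_form n c k \<theta>) (at 0)"
    using ray_expansion[OF assms(2)] ..
  then have c: "\<And>\<theta> k. \<forall>i\<ge>n. \<theta> i = 0 \<Longrightarrow>
    ((\<lambda>u. (f (\<lambda>i. u * \<theta> i) - (\<Sum>j<k. word_form n c j \<theta> * u ^ j)) / u ^ k) \<longlongrightarrow> word_form n c k \<theta>) (at 0)"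
    by simp
  have h_ray: "h (\<theta>(n := u)) = f (\<lambda>i. u * \<theta> i)" if "\<theta> \<in> cube n \<delta>" for \<theta> u
    unfolding h_def using cubeD(2)[OF that] by (intro arg_cong[of _ _ f]) (auto simp: fun_eq_iff)
  have ray: "(\<lambda>j. word_form n c j \<theta> * u ^ j) sums f (\<lambda>i. u * \<theta> i)" (is ?sums)
    and form_bound: "\<bar>word_form n c j \<theta>\<bar> \<le> M * (2 / \<delta>) ^ j" (is ?bound)
    if th: "\<theta> \<in> cube n \<delta>" and u: "\<bar>u\<bar> < \<delta>" for \<theta> u j
  proof -
    obtain a where "\<forall>u. \<bar>u\<bar> < \<delta> \<longrightarrow> (\<lambda>j. a j * u ^ j) sums f (\<lambda>i. u * \<theta> i)"
      "\<forall>j. \<bar>a j\<bar> \<le> M * (2 / \<delta>) ^ j"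
      using holomorphic_real_power_series[OF \<delta> F(1)[OF th] F(2)[OF th] F(3)[OF th]]
      unfolding h_ray[OF th] by blast
    then have a: "\<And>u. \<bar>u\<bar> < \<delta> \<Longrightarrow> (\<lambda>j. a j * u ^ j) sums f (\<lambda>i. u * \<theta> i)"
      "\<And>j. \<bar>a j\<bar> \<le> M * (2 / \<delta>) ^ j"
      by simp_all
    have "a j = word_form n c j \<theta>" for j
      by (rule power_series_unique_asymptotic[OF \<delta> a(1) c]) (use cubeD(2)[OF th] in auto)
    then show ?sums ?bound using a(1)[OF u] a(2)[of j] by simp_all
  qed
  obtain d where "\<forall>k x. word_form n c k x = (\<Sum>\<alpha>\<in>multi_indices_deg n k. d \<alpha> * (\<Prod>i<n. x i ^ \<alpha> i))"
    using word_form_multi_index ..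
  then have d: "\<And>k x. word_form n c k x = (\<Sum>\<alpha>\<in>multi_indices_deg n k. d \<alpha> * (\<Prod>i<n. x i ^ \<alpha> i))"
    by simp
  \<comment> \<open>The product of \<open>2 / \<delta>\<close>, from the Cauchy estimate on the disc of radius \<open>\<delta> / 2\<close>, and \<open>8 / \<delta>\<close>, from \<open>coefficient_bound\<close>.\<close>
  define K where "K = 16 / \<delta>\<^sup>2"
  have "K > 0" using \<delta> by (simp add: K_def)
  have d_bound: "\<bar>d \<alpha>\<bar> \<le> M * K ^ (\<Sum>i<n. \<alpha> i)" if "\<alpha> \<in> multi_indices n" for \<alpha>
  proof -
    let ?k = "\<Sum>i<n. \<alpha> i"
    have "\<bar>d \<alpha>\<bar> \<le> M * (2 / \<delta>) ^ ?k * (8 / \<delta>) ^ ?k"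
    proof (rule coefficient_bound[OF _ \<delta> d])
      show "\<alpha> \<in> multi_indices_deg n ?k" using that by (simp add: multi_indices_deg_def)
      show "\<bar>word_form n c ?k x\<bar> \<le> M * (2 / \<delta>) ^ ?k" if "x \<in> cube n \<delta>" for x
        by (rule form_bound[OF that, of 0]) (use \<delta> in simp)
    qed
    also have "\<dots> = M * K ^ ?k"
      by (simp add: K_def power_mult_distrib[symmetric] power2_eq_square mult.assoc)
    finally show ?thesis .
  qed
  have "\<forall>\<^sub>F x in near_origin n. ((\<lambda>\<alpha>. d \<alpha> * (\<Prod>i<n. x i ^ \<alpha> i)) has_sum f x) (multi_indices n)"
  proof (rule eventually_near_originI)
    \<comment> \<open>In this cube \<open>K * \<bar>x i\<bar> \<le> 1 / 2\<close>.\<close>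
    show "\<delta>\<^sup>2 / 32 > 0" using \<delta> by simp
    fix x assume x: "x \<in> cube n (\<delta>\<^sup>2 / 32)"
    show "((\<lambda>\<alpha>. d \<alpha> * (\<Prod>i<n. x i ^ \<alpha> i)) has_sum f x) (multi_indices n)"
    proof (rule has_sum_multi_indices)
      have Kx: "K * \<bar>x i\<bar> \<le> 1 / 2" if "i < n" for i
        using cubeD(1)[OF x that] \<delta> by (simp add: K_def divide_simps)
      have term_bound: "norm (d \<alpha> * (\<Prod>i<n. x i ^ \<alpha> i)) \<le> M * (\<Prod>i<n. (1/2) ^ \<alpha> i)"
        if a: "\<alpha> \<in> multi_indices n" for \<alpha>
      proof -
        have "M \<ge> 0" 
          using order_trans[OF norm_ge_zero F(2)[OF origin_in_cube[OF \<delta>], of 0]] \<delta> by simp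
        have "norm (d \<alpha> * (\<Prod>i<n. x i ^ \<alpha> i)) \<le> M * K ^ (\<Sum>i<n. \<alpha> i) * (\<Prod>i<n. \<bar>x i\<bar> ^ \<alpha> i)"
          using mult_right_mono[OF d_bound[OF a], of "\<Prod>i<n. \<bar>x i\<bar> ^ \<alpha> i"]
          by (simp add: abs_mult abs_prod power_abs prod_nonneg)
        also have "\<dots> = M * (\<Prod>i<n. (K * \<bar>x i\<bar>) ^ \<alpha> i)"
          by (simp add: power_sum power_mult_distrib prod.distrib)
        also have "\<dots> \<le> M * (\<Prod>i<n. (1 / 2) ^ \<alpha> i)"
          using Kx \<open>M \<ge> 0\<close> \<open>K > 0\<close> by (intro mult_left_mono prod_mono conjI power_mono) auto
        finally show ?thesis .
      qed
      have "(\<lambda>\<alpha>. M * (\<Prod>i<n. (1/2::real) ^ \<alpha> i)) summable_on multi_indices n"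
        by (intro summable_on_cmult_right summable_geometric_multi_indices)
      from abs_summable_summable[OF Infinite_Sum.abs_summable_on_comparison_test'[OF this term_bound]]
      show "(\<lambda>\<alpha>. d \<alpha> * (\<Prod>i<n. x i ^ \<alpha> i)) summable_on multi_indices n" .
      define \<theta> where "\<theta> = (\<lambda>i. x i / (\<delta> / 2))"
      have x_eq: "x = (\<lambda>i. (\<delta> / 2) * \<theta> i)" using \<delta> by (simp add: \<theta>_def fun_eq_iff)
      have "\<theta> \<in> cube n \<delta>"
      proof -
        have "\<bar>\<theta> i\<bar> < \<delta>" if "i < n" for i
        proof -
          note cubeD(1)[OF x that]
          also have "\<delta>\<^sup>2 / 32 \<le> \<delta> * (\<delta> / 2)" by (simp add: power2_eq_square)
          finally show ?thesis using \<delta> by (simp add: \<theta>_def abs_divide pos_divide_less_eq)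
        qed
        then show ?thesis using cubeD(2)[OF x] by (simp add: cube_def \<theta>_def)
      qed
      then have "(\<lambda>j. word_form n c j \<theta> * (\<delta> / 2) ^ j) sums f (\<lambda>i. (\<delta> / 2) * \<theta> i)"
        by (rule ray) (use \<delta> in simp)
      then have "(\<lambda>j. word_form n c j x) sums f x"
        unfolding word_form_scale[symmetric] x_eq[symmetric] .
      then show "(\<lambda>k. \<Sum>\<alpha>\<in>multi_indices_deg n k. d \<alpha> * (\<Prod>i<n. x i ^ \<alpha> i)) sums f x"
        unfolding d .
    qed
  qed
  then show ?thesis
    unfolding analytic_germs_def by (intro CollectI exI[of _ f] conjI refl exI[of _ d])
qed

end

theorem mainTheorem1:
  fixes C :: "nat \<Rightarrow> germ set"
  assumes "quasianalytic_system C"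
    and "weierstrass_preparation C"
  shows "\<forall>n. C n = analytic_germs n"
proof (intro allI equalityI)
  interpret quasianalytic_system C by fact
  fix n
  show "analytic_germs n \<subseteq> C n" by (rule analytic_subset)
  show "C n \<subseteq> analytic_germs n"
  proof
    fix A assume A: "A \<in> C n"
    then have "A \<in> smooth_germs n"
      using subring[of n] by (auto simp: subring_of_smooth_germs_def)
    then obtain f where "A = germ n f" by (auto simp: smooth_germs_def)
    then show "A \<in> analytic_germs n" using C_fun_analytic[OF assms(2)] A by simp
  qed
qed

end
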